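(* Let $a\geq1$ be an integer and $f(X)=X^3-(aX^2+(a+3)X+1)$, with roots $\rho,\rho_2,\rho_3$, and let $L_f$ be the splitting field of $f$ over $\mathbb{Q}$. Let $\mathfrak{p}$ be a non-zero prime ideal of the ring of integers of $L_f$ not lying over $(2)\subset\mathbb{Z}$. Let $d\in L_f$ be such that (i) $d\in\mathfrak{p}$; (ii) $g(X)=f(X)+d^2\in L_f[X]$ is irreducible over $L_f$; (iii) $g(X)\equiv f(X)\pmod{\mathfrak{p}}$ has distinct roots. Let $E$ be the elliptic curve $Y^2=f(X)+d^2$ over $L_f$. Then: (1) $E$ has the $L_f$-rational points $P_1=(\rho,\pm d)$, $P_2=(\rho_2,\pm d)$, $P_3=(\rho_3,\pm d)$; (2) each of these points is of infinite order in $E(L_f)$; (3) $E(L_f)$ has rank at least two. *)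

theory Defs
  imports "HOL-Library.Extended_Nat" "HOL-Algebra.Generated_Fields"
    "HOL-Algebra.Algebraic_Closure_Type"
begin

text \<open>
  Number fields are subfields of the complex numbers, given by their carrier sets.
  HOL-Algebra represents polynomials by coefficient lists with the leading coefficient
  first, whereas \<^const>\<open>coeffs\<close> lists the constant coefficient first; hence
  \<open>poly_list\<close>.
\<close>

abbreviation complex_field :: "complex ring"
  where "complex_field \<equiv> ring_of_type_algebra"

definition poly_list :: "'a::zero poly \<Rightarrow> 'a list"
  where "poly_list p = rev (coeffs p)"

text \<open>The splitting field over the rationals inside the complex numbers;
  a generated field contains the prime field.\<close>

definition splitting_field :: "complex poly \<Rightarrow> complex set"
  where "splitting_field p = generate_field complex_field {x. poly p x = 0}"

definition irreducible_over :: "complex set \<Rightarrow> complex poly \<Rightarrow> bool"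
  where "irreducible_over L p \<longleftrightarrow> pirreducible\<^bsub>complex_field\<^esub> L (poly_list p)"

definition ring_of_integers :: "complex set \<Rightarrow> complex ring"
  where "ring_of_integers L = complex_field\<lparr>carrier := {x \<in> L. algebraic_int x}\<rparr>"

definition lies_over :: "complex set \<Rightarrow> int \<Rightarrow> bool"
  where "lies_over \<pp> m \<longleftrightarrow> {n::int. of_int n \<in> \<pp>} = {n. m dvd n}"

text \<open>Coefficientwise reduction of a polynomial with coefficients in \<open>R\<close> modulo the
  ideal \<open>I\<close>, as a polynomial over the quotient ring.\<close>

definition reduce_poly :: "complex ring \<Rightarrow> complex set \<Rightarrow> complex poly \<Rightarrow> complex set list"
  where "reduce_poly R I p = map (\<lambda>c. I +>\<^bsub>R\<^esub> c) (poly_list p)"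

text \<open>The polynomial has as many distinct roots in \<open>k\<close> as its degree.  When it splits over
  the field \<open>k\<close>, this says that its roots in an algebraic closure of \<open>k\<close>
  are pairwise distinct.\<close>

definition has_distinct_roots :: "('a, 'b) ring_scheme \<Rightarrow> 'a list \<Rightarrow> bool"
  where "has_distinct_roots k p \<longleftrightarrow>
    card {x \<in> carrier k. ring.eval k p x = \<zero>\<^bsub>k\<^esub>} = length p - 1"

definition cubic_f :: "int \<Rightarrow> complex poly"
  where "cubic_f a = [:0, 1:] ^ 3 - [:1, of_int (a + 3), of_int a:]"

text \<open>
  The group of \<open>L\<close>-rational points of \<open>Y\<^sup>2 = g(X)\<close>, for a monic separable cubic \<open>g\<close>
  with coefficients in \<open>L\<close>, with the chord-and-tangent law and the point at infinity as
  neutral element.  In characteristic 0 separability, and with it smoothness of the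
  curve, follows from irreducibility of \<open>g\<close>.
\<close>

datatype 'a point = Infinity | Affine 'a 'a

fun chord_tangent :: "'a::field poly \<Rightarrow> 'a point \<Rightarrow> 'a point \<Rightarrow> 'a point"
  where
    "chord_tangent g Infinity Q = Q"
  | "chord_tangent g P Infinity = P"
  | "chord_tangent g (Affine x1 y1) (Affine x2 y2) =
      (if x1 = x2 \<and> y1 = - y2 then Infinity
       else
         let m = (if x1 = x2 then poly (pderiv g) x1 / (2 * y1) else (y2 - y1) / (x2 - x1));
             x3 = m ^ 2 - poly.coeff g 2 - x1 - x2
         in Affine x3 (- (y1 + m * (x3 - x1))))"

definition elliptic_curve_group :: "'a::field set \<Rightarrow> 'a poly \<Rightarrow> 'a point monoid"
  where "elliptic_curve_group L g =
    \<lparr> carrier = {Infinity} \<union> {Affine x y | x y. x \<in> L \<and> y \<in> L \<and> y ^ 2 = poly g x},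
      monoid.mult = chord_tangent g,
      monoid.one = Infinity \<rparr>"

definition has_infinite_order :: "('a, 'b) monoid_scheme \<Rightarrow> 'a \<Rightarrow> bool"
  where "has_infinite_order G x \<longleftrightarrow> (\<forall>n::nat. n > 0 \<longrightarrow> x [^]\<^bsub>G\<^esub> n \<noteq> \<one>\<^bsub>G\<^esub>)"

text \<open>The rank of an abelian group (written multiplicatively): the supremum of the
  cardinalities of its finite \<open>\<int>\<close>-linearly independent subsets.\<close>

definition Z_independent :: "('a, 'b) monoid_scheme \<Rightarrow> 'a set \<Rightarrow> bool"
  where "Z_independent G S \<longleftrightarrow>
    (\<forall>c :: 'a \<Rightarrow> int. (\<Otimes>\<^bsub>G\<^esub>x\<in>S. x [^]\<^bsub>G\<^esub> c x) = \<one>\<^bsub>G\<^esub> \<longrightarrow> (\<forall>x\<in>S. c x = 0))"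

definition group_rank :: "('a, 'b) monoid_scheme \<Rightarrow> enat"
  where "group_rank G =
    (SUP S \<in> {S. S \<subseteq> carrier G \<and> finite S \<and> Z_independent G S}. enat (card S))"

end

theory Submission
  imports Defs
begin

text \<open>
  Since \<open>d \<in> \<pp>\<close>, the points \<open>(\<rho>\<^sub>i, \<plusminus>d)\<close> reduce modulo \<open>\<pp>\<close> to the three distinct points of order
  two \<open>(\<rho>\<^sub>i, 0)\<close>, whereas \<open>E(L)\<close> itself has no point of order two because \<open>g\<close> has no root in \<open>L\<close>.
  If \<open>m P\<^sub>1 + n P\<^sub>2 = 0\<close>, then reduction shows that \<open>m\<close> and \<open>n\<close> are even, hence
  \<open>(m/2) P\<^sub>1 + (n/2) P\<^sub>2\<close> is killed by \<open>2\<close> and therefore vanishes; by infinite descent \<open>m = n = 0\<close>.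

  The reduction map is only needed on the group generated by the \<open>P\<^sub>i\<close>. There it is replaced by
  its fibres, defined through a valuation ring of the complex numbers that dominates the
  localization of the ring of integers at \<open>\<pp>\<close>. The explicit formula for adding \<open>(\<rho>\<^sub>i, \<plusminus>d)\<close>
  shows how these fibres are permuted.
\<close>

section \<open>Valuation rings dominating a prime ideal\<close>

text \<open>Reducing a point only asks, for each abscissa \<open>x\<close>, whether \<open>x\<close>
  is integral or \<open>1/x\<close> lies in the maximal ideal. A valuation ring decides this for
  every element of the field, and Zorn's lemma yields one above any prime ideal of a subring of a
  field. The only trouble is that the slope of a chord may have a pole at the place; it is
  controlled because it always enters multiplied by \<open>d\<close>, which is small there.
  Independence of two of the points carries both remaining claims: infinite order is the case of one
  zero exponent, and the two points witness the rank. A second obstacle is the group law itself,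
  since powers and independence make sense only once associativity is known. The absence of rational
  points of order two serves twice: it allows relations to be halved, and it keeps doubled ordinates
  nonzero, which makes the parabola through three points unique.\<close>

definition is_subring :: "'a::comm_ring_1 set \<Rightarrow> bool"
  where "is_subring B \<longleftrightarrow> 1 \<in> B \<and> (\<forall>x \<in> B. \<forall>y \<in> B. x - y \<in> B \<and> x * y \<in> B)"

definition is_ideal :: "'a::comm_ring_1 set \<Rightarrow> 'a set \<Rightarrow> bool"
  where "is_ideal B I \<longleftrightarrow>
    I \<subseteq> B \<and> 0 \<in> I \<and> (\<forall>x \<in> I. \<forall>y \<in> I. x + y \<in> I) \<and> (\<forall>b \<in> B. \<forall>x \<in> I. b * x \<in> I)"

lemma
  assumes "is_subring B"
  shows subring_1: "1 \<in> B" and subring_0: "0 \<in> B"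
    and subring_diff: "x \<in> B \<Longrightarrow> y \<in> B \<Longrightarrow> x - y \<in> B"
    and subring_mult: "x \<in> B \<Longrightarrow> y \<in> B \<Longrightarrow> x * y \<in> B"
    and subring_uminus: "x \<in> B \<Longrightarrow> - x \<in> B"
    and subring_add: "x \<in> B \<Longrightarrow> y \<in> B \<Longrightarrow> x + y \<in> B"
    and subring_power: "x \<in> B \<Longrightarrow> x ^ n \<in> B"
proof -
  show 1: "1 \<in> B"
    using assms by (simp add: is_subring_def)
  show d: "x - y \<in> B" if "x \<in> B" "y \<in> B" for x y
    using assms that by (simp add: is_subring_def)
  show 0: "0 \<in> B"
    using assms unfolding is_subring_def by (metis diff_self)
  show u: "- x \<in> B" if "x \<in> B" for x
    using d[OF 0 that] by simp
  show "x + y \<in> B" if "x \<in> B" "y \<in> B"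
    using d[OF that(1) u[OF that(2)]] by simp
  show "x ^ n \<in> B" if "x \<in> B"
    using that assms by (induction n) (auto simp: is_subring_def)
qed (use assms in \<open>auto simp: is_subring_def\<close>)

lemma
  assumes "is_ideal B I"
  shows ideal_subset: "x \<in> I \<Longrightarrow> x \<in> B" and ideal_0: "0 \<in> I"
    and ideal_add: "x \<in> I \<Longrightarrow> y \<in> I \<Longrightarrow> x + y \<in> I"
    and ideal_mult: "b \<in> B \<Longrightarrow> x \<in> I \<Longrightarrow> b * x \<in> I"
  using assms by (auto simp: is_ideal_def)

lemma ideal_uminus:
  assumes "is_subring B" "is_ideal B I" "x \<in> I"
  shows "- x \<in> I"
  using ideal_mult[OF assms(2) subring_uminus[OF assms(1) subring_1[OF assms(1)]] assms(3)] by simp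

lemma ideal_diff:
  assumes "is_subring B" "is_ideal B I" "x \<in> I" "y \<in> I"
  shows "x - y \<in> I"
  using ideal_add[OF assms(2,3) ideal_uminus[OF assms(1,2,4)]] by simp

lemma ideal_sum:
  assumes "is_ideal B I" "\<And>i. i \<in> T \<Longrightarrow> h i \<in> I"
  shows "sum h T \<in> I"
  using assms(2) by (induction T rule: infinite_finite_induct)
    (auto intro: ideal_0[OF assms(1)] ideal_add[OF assms(1)])

lemma is_ideal_self: "is_subring B \<Longrightarrow> is_ideal B B"
  by (simp add: is_ideal_def subring_0 subring_add subring_mult)

section \<open>Adjoining an element to a ring and extending its ideals\<close>

definition polys_over :: "'a::comm_ring_1 set \<Rightarrow> 'a poly set"
  where "polys_over S = {q. \<forall>i. coeff q i \<in> S}"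

text \<open>Serves two purposes: for a ring \<open>B\<close> it is B[x], for an ideal
  \<open>I\<close> of \<open>B\<close> it is the extended ideal I B[x].\<close>

definition adjoin :: "'a::comm_ring_1 set \<Rightarrow> 'a \<Rightarrow> 'a set"
  where "adjoin S x = (\<lambda>q. poly q x) ` polys_over S"

lemma polys_over_add:
  "is_ideal B I \<Longrightarrow> q \<in> polys_over I \<Longrightarrow> r \<in> polys_over I \<Longrightarrow> q + r \<in> polys_over I"
  by (simp add: polys_over_def ideal_add)

lemma polys_over_diff:
  "is_subring B \<Longrightarrow> is_ideal B I \<Longrightarrow> q \<in> polys_over I \<Longrightarrow> r \<in> polys_over I \<Longrightarrow> q - r \<in> polys_over I"
  by (simp add: polys_over_def ideal_diff)

lemma polys_over_mult:
  "is_ideal B I \<Longrightarrow> q \<in> polys_over B \<Longrightarrow> r \<in> polys_over I \<Longrightarrow> q * r \<in> polys_over I"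
  by (auto simp: polys_over_def coeff_mult intro!: ideal_sum ideal_mult)

lemma polys_over_monom:
  "is_ideal B I \<Longrightarrow> c \<in> I \<Longrightarrow> monom c n \<in> polys_over I"
  by (simp add: polys_over_def ideal_0)

lemma is_ideal_adjoin:
  assumes "is_ideal B I"
  shows "is_ideal (adjoin B x) (adjoin I x)"
  unfolding is_ideal_def adjoin_def
proof (intro conjI ballI)
  show "(\<lambda>q. poly q x) ` polys_over I \<subseteq> (\<lambda>q. poly q x) ` polys_over B"
    using ideal_subset[OF assms] by (auto simp: polys_over_def)
  show "0 \<in> (\<lambda>q. poly q x) ` polys_over I"
    by (rule image_eqI[of _ _ 0]) (simp_all add: polys_over_def ideal_0[OF assms])
qed (auto simp flip: poly_add poly_mult intro!: imageI polys_over_add[OF assms] polys_over_mult[OF assms])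

lemma is_subring_adjoin:
  assumes "is_subring B"
  shows "is_subring (adjoin B x)"
proof -
  note B = is_ideal_self[OF assms]
  have "1 \<in> polys_over B"
    by (auto simp: polys_over_def coeff_1 subring_0[OF assms] subring_1[OF assms])
  then have "1 \<in> adjoin B x"
    unfolding adjoin_def by (metis image_eqI poly_1)
  then show ?thesis
    unfolding is_subring_def adjoin_def
    by (auto simp flip: poly_diff poly_mult intro!: imageI polys_over_diff[OF assms B] polys_over_mult[OF B])
qed

lemma subset_adjoin: "0 \<in> S \<Longrightarrow> S \<subseteq> adjoin S x"
  unfolding adjoin_def polys_over_def
proof
  fix c assume "0 \<in> S" "c \<in> S"
  then show "c \<in> (\<lambda>q. poly q x) ` {q. \<forall>i. coeff q i \<in> S}"
    by (intro image_eqI[of _ _ "[:c:]"]) (auto simp: coeff_pCons split: nat.split)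
qed

lemma mem_adjoin:
  assumes "is_subring B"
  shows "x \<in> adjoin B x"
proof (unfold adjoin_def, rule image_eqI)
  show "monom 1 1 \<in> polys_over B"
    by (rule polys_over_monom[OF is_ideal_self[OF assms] subring_1[OF assms]])
qed (simp add: poly_monom)

text \<open>Chevalley's extension theorem: a maximal pair of a ring containing \<open>A\<close> and an ideal
  that contains \<open>\<pp>\<close> and avoids \<open>A - \<pp>\<close> is a valuation ring with its maximal ideal.\<close>

definition extends_prime :: "'a::field set \<Rightarrow> 'a set \<Rightarrow> 'a set \<Rightarrow> 'a set \<Rightarrow> bool"
  where "extends_prime A \<pp> B I \<longleftrightarrow>
    is_subring B \<and> is_ideal B I \<and> A \<subseteq> B \<and> \<pp> \<subseteq> I \<and> I \<inter> (A - \<pp>) = {}"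

lemma maximal_extension_exists:
  fixes A :: "'a::field set"
  assumes "extends_prime A \<pp> A \<pp>"
  obtains V M where "extends_prime A \<pp> V M"
    "\<And>B I. extends_prime A \<pp> B I \<Longrightarrow> V \<subseteq> B \<Longrightarrow> M \<subseteq> I \<Longrightarrow> B = V \<and> I = M"
proof -
  \<comment> \<open>Zorn's lemma for inclusion speaks about single sets, so a pair (ring, ideal) is
    coded as one subset of a disjoint union; the tag \<open>True\<close> marks the ideal.\<close>
  define ring where "ring W = {x. (x, False) \<in> W}" for W :: "('a \<times> bool) set"
  define idl where "idl W = {x. (x, True) \<in> W}" for W :: "('a \<times> bool) set"
  define pair where "pair B I = B \<times> {False} \<union> I \<times> {True}" for B I :: "'a set"
  have pair [simp]: "ring (pair B I) = B" "idl (pair B I) = I" for B I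
    by (auto simp: ring_def idl_def pair_def)
  have mono: "ring W \<subseteq> ring W'" "idl W \<subseteq> idl W'" if "W \<subseteq> W'" for W W'
    using that by (auto simp: ring_def idl_def)
  define \<A> where "\<A> = {W. extends_prime A \<pp> (ring W) (idl W)}"
  have "\<exists>W \<in> \<A>. \<forall>Z \<in> \<A>. W \<subseteq> Z \<longrightarrow> Z = W"
  proof (rule subset_Zorn_nonempty)
    show "\<A> \<noteq> {}"
      using assms pair unfolding \<A>_def by (metis empty_iff mem_Collect_eq)
    fix C assume C: "C \<noteq> {}" "subset.chain \<A> C"
    \<comment> \<open>Every closure axiom involves at most two elements, and in a chain these
      already lie in a common member.\<close>
    have two: "\<exists>W \<in> C. w \<in> W \<and> w' \<in> W" if "w \<in> \<Union>C" "w' \<in> \<Union>C" for w w'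
      using that C(2) unfolding subset.chain_def by blast
    have ext: "extends_prime A \<pp> (ring W) (idl W)" if "W \<in> C" for W
      using that C(2) unfolding subset.chain_def \<A>_def by blast
    have r2: "\<exists>W \<in> C. x \<in> ring W \<and> y \<in> ring W" if "x \<in> ring (\<Union>C)" "y \<in> ring (\<Union>C)" for x y
      using two that unfolding ring_def by blast
    have i2: "\<exists>W \<in> C. x \<in> idl W \<and> y \<in> idl W" if "x \<in> idl (\<Union>C)" "y \<in> idl (\<Union>C)" for x y
      using two that unfolding idl_def by blast
    have ri2: "\<exists>W \<in> C. x \<in> ring W \<and> y \<in> idl W" if "x \<in> ring (\<Union>C)" "y \<in> idl (\<Union>C)" for x y
      using two that unfolding ring_def idl_def by blast
    have up: "ring W \<subseteq> ring (\<Union>C)" "idl W \<subseteq> idl (\<Union>C)" if "W \<in> C" for W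
      using mono that by blast+
    obtain W where W: "W \<in> C"
      using C(1) by blast
    have sub: "is_subring (ring W)" and idl: "is_ideal (ring W) (idl W)" if "W \<in> C" for W
      using ext[OF that] by (auto simp: extends_prime_def)
    have "is_subring (ring (\<Union>C))"
      unfolding is_subring_def
    proof (intro conjI ballI)
      show "1 \<in> ring (\<Union>C)"
        using up(1)[OF W] subring_1[OF sub[OF W]] by blast
      fix x y assume "x \<in> ring (\<Union>C)" "y \<in> ring (\<Union>C)"
      then obtain W where W: "W \<in> C" "x \<in> ring W" "y \<in> ring W"
        using r2 by blast
      show "x - y \<in> ring (\<Union>C)" "x * y \<in> ring (\<Union>C)"
        using up(1)[OF W(1)] subring_diff[OF sub[OF W(1)] W(2,3)] subring_mult[OF sub[OF W(1)] W(2,3)]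
        by auto
    qed
    moreover have "is_ideal (ring (\<Union>C)) (idl (\<Union>C))"
      unfolding is_ideal_def
    proof (intro conjI ballI subsetI)
      show "0 \<in> idl (\<Union>C)"
        using up(2)[OF W] ideal_0[OF idl[OF W]] by blast
      show "x \<in> ring (\<Union>C)" if "x \<in> idl (\<Union>C)" for x
        using i2[OF that that] ideal_subset[OF idl] up(1) by blast
      show "x + y \<in> idl (\<Union>C)" if "x \<in> idl (\<Union>C)" "y \<in> idl (\<Union>C)" for x y
        using i2[OF that] ideal_add[OF idl] up(2) by blast
      show "x * y \<in> idl (\<Union>C)" if "x \<in> ring (\<Union>C)" "y \<in> idl (\<Union>C)" for x y
        using ri2[OF that] ideal_mult[OF idl] up(2) by blast
    qed
    moreover have "A \<subseteq> ring (\<Union>C)" "\<pp> \<subseteq> idl (\<Union>C)"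
      using ext[OF W] up[OF W] by (auto simp: extends_prime_def)
    moreover have "idl (\<Union>C) \<inter> (A - \<pp>) = {}"
      using ext i2 unfolding extends_prime_def by blast
    ultimately show "\<Union>C \<in> \<A>"
      by (simp add: \<A>_def extends_prime_def)
  qed
  then obtain W where W: "W \<in> \<A>" "\<And>Z. Z \<in> \<A> \<Longrightarrow> W \<subseteq> Z \<Longrightarrow> Z = W"
    by blast
  show thesis
  proof (rule that[of "ring W" "idl W"])
    show "extends_prime A \<pp> (ring W) (idl W)"
      using W(1) by (simp add: \<A>_def)
    fix B I assume *: "extends_prime A \<pp> B I" "ring W \<subseteq> B" "idl W \<subseteq> I"
    have "pair B I \<in> \<A>"
      using *(1) by (simp add: \<A>_def)
    moreover have "W \<subseteq> pair B I"
    proof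
      fix w assume "w \<in> W"
      then show "w \<in> pair B I"
        using *(2,3) by (cases w; cases "snd w") (auto simp: ring_def idl_def pair_def)
    qed
    ultimately have "pair B I = W"
      by (rule W(2))
    then show "B = ring W \<and> I = idl W"
      using pair by metis
  qed
qed

section \<open>Maximal pairs are valuation rings\<close>

locale maximal_extension =
  fixes A \<pp> V M :: "'a::field set"
  assumes subring_A: "is_subring A"
    and prime: "x \<in> A \<Longrightarrow> y \<in> A \<Longrightarrow> x * y \<in> \<pp> \<Longrightarrow> x \<in> \<pp> \<or> y \<in> \<pp>"
    and one_notin: "1 \<notin> \<pp>"
    and ext: "extends_prime A \<pp> V M"
    and max: "extends_prime A \<pp> B I \<Longrightarrow> V \<subseteq> B \<Longrightarrow> M \<subseteq> I \<Longrightarrow> B = V \<and> I = M"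
begin

lemma V: "is_subring V" and M: "is_ideal V M" and A_V: "A \<subseteq> V" and \<pp>_M: "\<pp> \<subseteq> M"
  and disj: "x \<in> A \<Longrightarrow> x \<in> M \<Longrightarrow> x \<in> \<pp>"
  using ext by (auto simp: extends_prime_def)

lemma one_notin_M: "1 \<notin> M"
  using disj subring_1[OF subring_A] one_notin by blast

text \<open>If the extension of \<open>M\<close> to V[1/s] met \<open>A - \<pp>\<close> in
  \<open>t\<close>, clearing denominators by a power of \<open>s\<close> would put s^n t into
  \<open>M\<close>. Hence the pair with 1/s adjoined is admissible, and maximality absorbs 1/s into
  \<open>V\<close>.\<close>

lemma inverse_mem_V:
  assumes s: "s \<in> V" "s \<noteq> 0" and av: "\<And>n t. t \<in> A - \<pp> \<Longrightarrow> s ^ n * t \<notin> M"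
  shows "inverse s \<in> V"
proof -
  have "adjoin M (inverse s) \<inter> (A - \<pp>) = {}"
  proof (rule ccontr)
    assume "adjoin M (inverse s) \<inter> (A - \<pp>) \<noteq> {}"
    then obtain q t where q: "q \<in> polys_over M" "t = poly q (inverse s)" "t \<in> A - \<pp>"
      by (auto simp: adjoin_def)
    have "s ^ degree q * t = poly (reflect_poly q) s"
      using s(2) by (simp add: q(2) poly_reflect_poly_nz)
    also have "\<dots> = (\<Sum>i\<le>degree (reflect_poly q). s ^ i * coeff (reflect_poly q) i)"
      by (simp add: poly_altdef mult.commute)
    also have "\<dots> \<in> M"
      using q(1) s(1) by (intro ideal_sum[OF M] ideal_mult[OF M] subring_power[OF V])
        (auto simp: polys_over_def coeff_reflect_poly ideal_0[OF M])
    finally show False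
      using av q(3) by blast
  qed
  then have "extends_prime A \<pp> (adjoin V (inverse s)) (adjoin M (inverse s))"
    unfolding extends_prime_def
    using is_subring_adjoin[OF V] is_ideal_adjoin[OF M] A_V \<pp>_M
      subset_adjoin[OF subring_0[OF V]] subset_adjoin[OF ideal_0[OF M]] by (metis order_trans)
  then have "adjoin V (inverse s) = V"
    using max subset_adjoin[OF subring_0[OF V]] subset_adjoin[OF ideal_0[OF M]] by blast
  then show ?thesis
    using mem_adjoin[OF V] by metis
qed

lemma power_mult_notin:
  assumes "s \<in> A - \<pp>" "t \<in> A - \<pp>"
  shows "s ^ n * t \<in> A - \<pp>"
proof (induction n)
  case (Suc n)
  then show ?case
    using prime[of s "s ^ n * t"] assms subring_mult[OF subring_A] by (auto simp: mult.assoc)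
qed (use assms in simp)

text \<open>Elements of \<open>A - \<pp>\<close> are units of \<open>V\<close> by
  \<open>inverse_mem_V\<close>, as their powers stay outside \<open>\<pp>\<close>. From here on
  maximality can be tested against arbitrary proper ideals.\<close>

lemma proper_ideal_avoids:
  assumes "is_ideal B I" "V \<subseteq> B" "1 \<notin> I"
  shows "I \<inter> (A - \<pp>) = {}"
proof (rule ccontr)
  assume "I \<inter> (A - \<pp>) \<noteq> {}"
  then obtain t where t: "t \<in> I" "t \<in> A - \<pp>"
    by blast
  then have "t \<noteq> 0"
    using disj ideal_0[OF M] \<pp>_M ext unfolding extends_prime_def by blast
  moreover have "inverse t \<in> V"
    using t(2) power_mult_notin[OF t(2)] A_V disj calculation
    by (intro inverse_mem_V) blast+
  ultimately show False
    using ideal_mult[OF assms(1) _ t(1), of "inverse t"] assms(2,3) by auto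
qed

lemma maximal_proper:
  assumes "is_subring B" "is_ideal B I" "1 \<notin> I" "V \<subseteq> B" "M \<subseteq> I"
  shows "B = V \<and> I = M"
  using assms A_V \<pp>_M proper_ideal_avoids[OF assms(2,4,3)]
  by (intro max) (auto simp: extends_prime_def)

text \<open>Powers of 1 - m are congruent to 1 modulo \<open>M\<close>, so (1 - m)^n t is congruent
  to \<open>t\<close> and cannot lie in \<open>M\<close>; thus \<open>inverse_mem_V\<close>
  applies.\<close>

lemma inverse_one_minus:
  assumes "m \<in> M"
  shows "1 - m \<noteq> 0" "inverse (1 - m) \<in> V"
proof -
  show nz: "1 - m \<noteq> 0"
    using assms one_notin_M by auto
  have mV: "m \<in> V"
    by (rule ideal_subset[OF M assms])
  have p: "1 - (1 - m) ^ n \<in> M" for n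
  proof (induction n)
    case (Suc n)
    have "1 - (1 - m) ^ Suc n = (1 - (1 - m) ^ n) + (1 - m) ^ n * m"
      by (simp add: algebra_simps)
    also have "\<dots> \<in> M"
      by (intro ideal_add[OF M] Suc.IH ideal_mult[OF M] subring_power[OF V] subring_diff[OF V]
          subring_1[OF V] assms mV)
    finally show ?case .
  qed (simp add: ideal_0[OF M])
  have "(1 - m) ^ n * t \<notin> M" if "t \<in> A - \<pp>" for n t
  proof
    assume a: "(1 - m) ^ n * t \<in> M"
    have "(1 - m) ^ n * t + t * (1 - (1 - m) ^ n) \<in> M"
      using that A_V by (intro ideal_add[OF M a] ideal_mult[OF M _ p]) auto
    then show False
      using that disj by (auto simp: algebra_simps)
  qed
  then show "inverse (1 - m) \<in> V"
    using nz mV by (intro inverse_mem_V subring_diff[OF V] subring_1[OF V])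
qed

text \<open>The ideal M + zV is strictly larger than \<open>M\<close>, so it contains 1; then z v =
  1 - m, whose right-hand side is already known to be a unit.\<close>

lemma inverse_mem_if_notin_M:
  assumes z: "z \<in> V" "z \<notin> M"
  shows "inverse z \<in> V"
proof -
  define I where "I = {m + z * v | m v. m \<in> M \<and> v \<in> V}"
  have I: "is_ideal V I"
    unfolding is_ideal_def
  proof (intro conjI ballI subsetI)
    show "0 \<in> I"
      unfolding I_def using ideal_0[OF M] subring_0[OF V] by force
    show "x \<in> V" if "x \<in> I" for x
      using that z(1) ideal_subset[OF M] by (auto simp: I_def intro!: subring_add[OF V] subring_mult[OF V])
    show "x + y \<in> I" if xy: "x \<in> I" "y \<in> I" for x y
    proof -
      obtain m v m' v' where "x = m + z * v" "y = m' + z * v'" "m \<in> M" "m' \<in> M" "v \<in> V" "v' \<in> V"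
        using xy by (auto simp: I_def)
      moreover from this have "x + y = (m + m') + z * (v + v')"
        by (simp add: algebra_simps)
      ultimately show ?thesis
        unfolding I_def using ideal_add[OF M] subring_add[OF V] by blast
    qed
    show "b * x \<in> I" if bx: "b \<in> V" "x \<in> I" for b x
    proof -
      obtain m v where "x = m + z * v" "m \<in> M" "v \<in> V"
        using bx by (auto simp: I_def)
      moreover from this have "b * x = b * m + z * (b * v)"
        by (simp add: algebra_simps)
      ultimately show ?thesis
        unfolding I_def using ideal_mult[OF M bx(1)] subring_mult[OF V bx(1)] by blast
    qed
  qed
  have "m = m + z * 0" for m
    by simp
  then have "M \<subseteq> I"
    unfolding I_def using subring_0[OF V] by blast
  moreover have "z = 0 + z * 1"
    by simp
  then have "z \<in> I"
    unfolding I_def using ideal_0[OF M] subring_1[OF V] by blast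
  ultimately have "1 \<in> I"
    using maximal_proper[OF V I] z(2) by blast
  then obtain m v where mv: "1 = m + z * v" "m \<in> M" "v \<in> V"
    by (auto simp: I_def)
  then have "z * v = 1 - m"
    by (simp add: algebra_simps)
  then have "inverse z = v * inverse (1 - m)"
    using inverse_one_minus(1)[OF mv(2)] by (metis inverse_mult_distrib mult.assoc mult.commute
        mult.left_neutral mult_zero_right right_inverse)
  then show ?thesis
    using mv inverse_one_minus(2) subring_mult[OF V] by simp
qed

text \<open>The relation for 1/x, multiplied by a power of \<open>x\<close>, expresses that power
  through lower ones with coefficients in \<open>M\<close>. Substituting it into the leading term of
  \<open>p\<close> lowers the degree.\<close>

lemma reduce_degree:
  assumes "x \<noteq> 0" "p \<in> polys_over M" "q \<in> polys_over M" "poly p x = 1" "poly q (inverse x) = 1"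
    and le: "degree q \<le> degree p"
  obtains p' where "p' \<in> polys_over M" "poly p' x = 1" "degree p' < degree p"
proof -
  have pos: "degree r > 0" if "r \<in> polys_over M" "poly r y = 1" for r y
  proof (rule ccontr)
    assume "\<not> degree r > 0"
    then obtain c where "r = [:c:]"
      by (meson degree_eq_zeroE neq0_conv)
    then show False
      using that one_notin_M by (auto simp: polys_over_def dest: spec[of _ 0])
  qed
  let ?m = "degree q" and ?n = "degree p"
  have m: "?m > 0" and n: "?n > 0"
    using pos assms by blast+
  define u where "u = inverse (1 - coeff q 0)"
  have q0: "coeff q 0 \<in> M"
    using assms(3) by (simp add: polys_over_def)
  have u: "u \<in> V" "u * (1 - coeff q 0) = 1"
    using inverse_one_minus[OF q0] by (simp_all add: u_def)
  \<comment> \<open>Reflection moves the constant term of \<open>q\<close> to the top; isolating it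
    and dividing by the unit 1 - \<open>coeff q 0\<close> gives \<open>r\<close> of degree below
    \<open>degree q\<close> with r(x) = x^(degree q).\<close>
  define r where "r = [:u:] * (reflect_poly q - monom (coeff q 0) ?m)"
  have "reflect_poly q \<in> polys_over M"
    using assms(3) by (auto simp: polys_over_def coeff_reflect_poly ideal_0[OF M])
  moreover have uV: "[:u:] \<in> polys_over V"
    using u(1) by (auto simp: polys_over_def coeff_pCons subring_0[OF V] split: nat.split)
  ultimately have r: "r \<in> polys_over M"
    unfolding r_def
    by (intro polys_over_mult[OF M] polys_over_diff[OF V M] polys_over_monom[OF M] q0)
  have "poly (reflect_poly q) x = x ^ ?m"
    using assms(1,5) by (simp add: poly_reflect_poly_nz)
  then have "poly r x = u * (1 - coeff q 0) * x ^ ?m"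
    by (simp add: r_def poly_monom algebra_simps)
  then have rx: "poly r x = x ^ ?m"
    by (simp add: u(2))
  have "degree (reflect_poly q - monom (coeff q 0) ?m) < ?m"
    using m by (intro degree_lessI) (auto simp: coeff_reflect_poly)
  then have dr: "degree r < ?m"
    unfolding r_def using le_less_trans[OF degree_smult_le] by simp
  define p' where "p' = (p - monom (lead_coeff p) ?n) + monom (lead_coeff p) (?n - ?m) * r"
  have lc: "lead_coeff p \<in> M"
    using assms(2) by (simp add: polys_over_def)
  show thesis
  proof (rule that)
    show "p' \<in> polys_over M"
      unfolding p'_def using lc ideal_subset[OF M lc] assms(2) r
      by (intro polys_over_add[OF M] polys_over_diff[OF V M] polys_over_mult[OF M]
          polys_over_monom[OF M] polys_over_monom[OF is_ideal_self[OF V]])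
    show "poly p' x = 1"
      using assms(4) le rx by (simp add: p'_def poly_monom mult.assoc flip: power_add)
    have "degree (p - monom (lead_coeff p) ?n) < ?n"
      using n by (intro degree_lessI) (auto simp: coeff_eq_0 le_less)
    moreover have "degree (monom (lead_coeff p) (?n - ?m) * r) < ?n"
      using degree_mult_le[of "monom (lead_coeff p) (?n - ?m)" r] degree_monom_le[of "lead_coeff p" "?n - ?m"]
        dr le by linarith
    ultimately show "degree p' < ?n"
      unfolding p'_def by (rule degree_add_less)
  qed
qed

text \<open>Descent on the sum of the degrees; when \<open>q\<close> has the larger degree,
  \<open>x\<close> and its inverse exchange roles.\<close>

lemma not_both_one:
  assumes "x \<noteq> 0" "p \<in> polys_over M" "q \<in> polys_over M" "poly p x = 1" "poly q (inverse x) = 1"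
  shows False
  using assms
proof (induction "degree p + degree q" arbitrary: p q x rule: less_induct)
  case less
  show ?case
  proof (cases "degree q \<le> degree p")
    case True
    then show ?thesis
      using reduce_degree[OF less.prems True] less by (metis add_less_cancel_right)
  next
    case False
    have "poly p (inverse (inverse x)) = 1"
      using less.prems by simp
    then show ?thesis
      using reduce_degree[of "inverse x" q p] less False
      by (metis add_less_cancel_left inverse_nonzero_iff_nonzero nat_le_linear)
  qed
qed

text \<open>Adjoining an element \<open>y\<close> outside \<open>V\<close> must destroy properness,
  so 1 lies in the extension of \<open>M\<close> to V[y]. By \<open>not_both_one\<close> this cannot
  happen for \<open>x\<close> and 1/x at once.\<close>

lemma notin_V_imp_inverse_mem_M:
  assumes "x \<notin> V"
  shows "inverse x \<in> M"
proof -
  have x: "x \<noteq> 0"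
    using assms subring_0[OF V] by blast
  have one: "1 \<in> adjoin M y" if "y \<notin> V" for y
    using maximal_proper[OF is_subring_adjoin[OF V] is_ideal_adjoin[OF M]] mem_adjoin[OF V] that
      subset_adjoin[OF subring_0[OF V]] subset_adjoin[OF ideal_0[OF M]] by metis
  have "inverse x \<in> V"
  proof (rule ccontr)
    assume "inverse x \<notin> V"
    then show False
      using one[OF assms] one[of "inverse x"] not_both_one[OF x] unfolding adjoin_def by (metis imageE)
  qed
  then show ?thesis
    using inverse_mem_if_notin_M[of "inverse x"] assms by auto
qed

end

theorem valuation_ring_extending_prime:
  fixes A \<pp> :: "'a::field set"
  assumes "is_subring A" "is_ideal A \<pp>" "1 \<notin> \<pp>"
    and "\<And>x y. x \<in> A \<Longrightarrow> y \<in> A \<Longrightarrow> x * y \<in> \<pp> \<Longrightarrow> x \<in> \<pp> \<or> y \<in> \<pp>"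
  obtains V M where "is_subring V" "is_ideal V M" "1 \<notin> M"
    "\<And>x. x \<notin> V \<Longrightarrow> inverse x \<in> M" "\<And>x. x \<in> V \<Longrightarrow> x \<notin> M \<Longrightarrow> inverse x \<in> V"
    "A \<subseteq> V" "\<pp> \<subseteq> M" "\<And>x. x \<in> A \<Longrightarrow> x \<in> M \<Longrightarrow> x \<in> \<pp>"
proof -
  have "extends_prime A \<pp> A \<pp>"
    using assms(1,2) by (auto simp: extends_prime_def)
  then obtain V M where VM: "extends_prime A \<pp> V M"
    "\<And>B I. extends_prime A \<pp> B I \<Longrightarrow> V \<subseteq> B \<Longrightarrow> M \<subseteq> I \<Longrightarrow> B = V \<and> I = M"
    by (rule maximal_extension_exists) blast
  interpret maximal_extension A \<pp> V M
    by unfold_locales (use assms VM in blast)+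
  show thesis
    using that[OF V M one_notin_M notin_V_imp_inverse_mem_M inverse_mem_if_notin_M A_V \<pp>_M disj] .
qed

section \<open>Associativity of the chord-and-tangent law\<close>

text \<open>Removes one linear factor at a time, so that repeated roots are counted with
  multiplicity.\<close>

lemma linear_factor_dvd_mult_cancel:
  fixes p q r :: "'a::idom poly"
  assumes "[:- x, 1:] * p dvd q * r" and "poly r x \<noteq> 0"
  obtains q' where "q = [:- x, 1:] * q'" and "p dvd q' * r"
proof -
  obtain s where s: "q * r = [:- x, 1:] * p * s"
    using assms(1) by (elim dvdE)
  have "poly q x * poly r x = 0"
    using arg_cong[OF s, of "\<lambda>t. poly t x"] by simp
  then have "poly q x = 0"
    using assms(2) by simp
  then obtain q' where q': "q = [:- x, 1:] * q'"
    by (metis dvdE poly_eq_0_iff_dvd)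
  have "[:- x, 1:] * (q' * r) = [:- x, 1:] * (p * s)"
    using s q' by (simp only: mult.assoc)
  then have "q' * r = p * s"
    by (metis mult_left_cancel pCons_eq_0_iff zero_neq_one)
  then show thesis
    using that q' by simp
qed

lemma chord_tangent_Affine:
  assumes "x1 = x2 \<Longrightarrow> y1 \<noteq> - y2"
    and "m = (if x1 = x2 then poly (pderiv g) x1 / (2 * y1) else (y2 - y1) / (x2 - x1))"
    and "x3 = m ^ 2 - poly.coeff g 2 - x1 - x2"
  shows "chord_tangent g (Affine x1 y1) (Affine x2 y2) = Affine x3 (- (y1 + m * (x3 - x1)))"
  unfolding assms(3) chord_tangent.simps Let_def assms(2)[symmetric] using assms(1) by auto

fun point_neg :: "'a::uminus point \<Rightarrow> 'a point"
  where
    "point_neg Infinity = Infinity"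
  | "point_neg (Affine x y) = Affine x (- y)"

section \<open>Chords and tangents as factorizations\<close>

locale cubic_curve =
  fixes g0 g1 g2 :: "'a::field" and g :: "'a poly"
  defines "g \<equiv> [:g0, g1, g2, 1:]"
begin

text \<open>Turns the case distinction of \<open>chord_tangent\<close> into a single statement: the
  line meets the cubic in three points counted with multiplicity.\<close>

lemma chord_exists:
  assumes "y1 ^ 2 = poly g x1" "y2 ^ 2 = poly g x2" "x1 = x2 \<Longrightarrow> y1 \<noteq> - y2" "(2::'a) \<noteq> 0"
  obtains c m x3 where
    "g - [:c, m:] ^ 2 = [:- x1, 1:] * [:- x2, 1:] * [:- x3, 1:]"
    "y1 = poly [:c, m:] x1" "y2 = poly [:c, m:] x2"
    "chord_tangent g (Affine x1 y1) (Affine x2 y2) = Affine x3 (- poly [:c, m:] x3)"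
proof -
  define m where "m = (if x1 = x2 then poly (pderiv g) x1 / (2 * y1) else (y2 - y1) / (x2 - x1))"
  define c where "c = y1 - m * x1"
  define x3 where "x3 = m ^ 2 - g2 - x1 - x2"
  \<comment> \<open>\<open>h0 + h1 * X\<close> is the difference between g minus the squared line
    and the product of the three factors; the choice of \<open>x3\<close> has cancelled the
    quadratic term.\<close>
  define h0 where "h0 = g0 - c ^ 2 + x1 * x2 * x3"
  define h1 where "h1 = g1 - 2 * m * c - (x1 * x2 + x1 * x3 + x2 * x3)"
  have y1: "y1 = c + m * x1"
    by (simp add: c_def)
  have y2: "y2 = c + m * x2"
  proof (cases "x1 = x2")
    case True
    then have "(y1 - y2) * (y1 + y2) = 0"
      using assms(1,2) by (simp add: algebra_simps power2_eq_square)
    moreover have "y1 + y2 \<noteq> 0"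
      using assms(3) True by (metis add_eq_0_iff2)
    ultimately show ?thesis
      using y1 True by simp
  next
    case False
    then have "m * (x2 - x1) = y2 - y1"
      by (simp add: m_def)
    then show ?thesis
      by (simp add: c_def algebra_simps)
  qed
  have e1: "h0 + h1 * x1 = 0"
    using assms(1) unfolding y1 g_def h0_def h1_def x3_def
    by (simp add: algebra_simps power2_eq_square power3_eq_cube)
  have e2: "h0 + h1 * x2 = 0"
    using assms(2) unfolding y2 g_def h0_def h1_def x3_def
    by (simp add: algebra_simps power2_eq_square power3_eq_cube)
  \<comment> \<open>For a tangent \<open>e1\<close> and \<open>e2\<close> coincide, and the missing
    equation is supplied by the slope, that is, by the derivative at the double root.\<close>
  have h1: "h1 = 0"
  proof (cases "x1 = x2")
    case True
    have "y1 \<noteq> 0"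
      using assms(1-3) True by auto
    then have "2 * y1 * m = poly (pderiv g) x1"
      using assms(4) True by (simp add: m_def)
    then have "2 * (c + m * x1) * m = g1 + 2 * g2 * x1 + 3 * x1 ^ 2"
      unfolding g_def y1 by (simp add: pderiv_pCons algebra_simps power2_eq_square)
    then show ?thesis
      unfolding h1_def x3_def using True by (simp add: algebra_simps power2_eq_square)
  next
    case False
    then show ?thesis
      using e1 e2 by (metis add_left_cancel mult_cancel_left)
  qed
  have "h0 = 0"
    using e1 h1 by simp
  then have "g - [:c, m:] ^ 2 = [:- x1, 1:] * [:- x2, 1:] * [:- x3, 1:]"
    using h1 unfolding g_def h0_def h1_def x3_def
    by (simp add: algebra_simps power2_eq_square)
  moreover have "y1 = poly [:c, m:] x1" "y2 = poly [:c, m:] x2"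
    by (simp_all add: y1 y2)
  moreover have "chord_tangent g (Affine x1 y1) (Affine x2 y2) = Affine x3 (- poly [:c, m:] x3)"
  proof -
    have "chord_tangent g (Affine x1 y1) (Affine x2 y2) = Affine x3 (- (y1 + m * (x3 - x1)))"
      by (rule chord_tangent_Affine[OF assms(3) m_def]) (simp_all add: x3_def g_def numeral_2_eq_2)
    moreover have "y1 + m * (x3 - x1) = poly [:c, m:] x3"
      by (simp add: c_def algebra_simps)
    ultimately show ?thesis
      by simp
  qed
  ultimately show thesis
    by (rule that)
qed

text \<open>Such a factorization determines the slope. Since its right-hand side is symmetric,
  permuting or reflecting the points yields identities of the group law.\<close>

lemma chord_unique:
  assumes "g - [:c, m:] ^ 2 = [:- x1, 1:] * [:- x2, 1:] * [:- x3, 1:]"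
    and "x1 = x2 \<Longrightarrow> 2 * poly [:c, m:] x1 \<noteq> 0"
  shows "chord_tangent g (Affine x1 (poly [:c, m:] x1)) (Affine x2 (poly [:c, m:] x2)) =
    Affine x3 (- poly [:c, m:] x3)"
proof -
  have v: "g2 - m ^ 2 = - (x1 + x2 + x3)" "g1 - 2 * m * c = x1 * x2 + x1 * x3 + x2 * x3"
    using assms(1) unfolding g_def by (simp_all add: algebra_simps power2_eq_square)
  define m' where "m' = (if x1 = x2 then poly (pderiv g) x1 / (2 * poly [:c, m:] x1)
    else (poly [:c, m:] x2 - poly [:c, m:] x1) / (x2 - x1))"
  have "m' = m"
  proof (cases "x1 = x2")
    case True
    have g: "g2 = m ^ 2 - (x1 + x2 + x3)" "g1 = 2 * m * c + (x1 * x2 + x1 * x3 + x2 * x3)"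
      using v by (simp_all add: algebra_simps)
    have "poly (pderiv g) x1 = m * (2 * poly [:c, m:] x1)"
      unfolding g_def using True by (simp add: g pderiv_pCons algebra_simps power2_eq_square)
    then show ?thesis
      using assms(2) True by (simp add: m'_def)
  next
    case False
    then show ?thesis
      by (simp add: m'_def field_simps)
  qed
  moreover have "x1 = x2 \<Longrightarrow> poly [:c, m:] x1 \<noteq> - poly [:c, m:] x2"
    using assms(2) by (metis add.right_inverse mult_2)
  moreover have "x3 = m ^ 2 - g2 - x1 - x2"
    using v(1) by (simp add: algebra_simps)
  ultimately have "chord_tangent g (Affine x1 (poly [:c, m:] x1)) (Affine x2 (poly [:c, m:] x2)) =
      Affine x3 (- (poly [:c, m:] x1 + m * (x3 - x1)))"
    using m'_def by (intro chord_tangent_Affine) (simp_all add: g_def numeral_2_eq_2)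
  moreover have "poly [:c, m:] x1 + m * (x3 - x1) = poly [:c, m:] x3"
    by (simp add: algebra_simps)
  ultimately show ?thesis
    by (simp only:)
qed

text \<open>Keeps products of linear factors factored; the simplifier would otherwise expand them
  into coefficients.\<close>

declare mult_pCons_left [simp del] mult_pCons_right [simp del]

text \<open>The parabola \<open>y = Y(x)\<close> interpolates the divisor \<open>P + Q + R\<close> with multiplicities.
  It is symmetric in the three points and determines their sum, whence associativity.\<close>

definition interpolates :: "'a poly \<Rightarrow> 'a \<Rightarrow> 'a \<Rightarrow> 'a \<Rightarrow> 'a \<Rightarrow> 'a \<Rightarrow> 'a \<Rightarrow> bool"
  where "interpolates Y x1 y1 x2 y2 x3 y3 \<longleftrightarrow>
    degree Y \<le> 2 \<and> poly Y x1 = y1 \<and> poly Y x2 = y2 \<and> poly Y x3 = y3 \<and>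
    [:- x1, 1:] * ([:- x2, 1:] * [:- x3, 1:]) dvd g - Y ^ 2"

text \<open>For a genuine parabola g - Y^2 is a quartic with leading coefficient -(coeff Y 2)^2; its
  fourth zero gives a point that complements the other three to sum zero, hence the reflected
  ordinate. If the quadratic coefficient vanishes, the three points are collinear.\<close>

definition parabola_sum :: "'a poly \<Rightarrow> 'a \<Rightarrow> 'a \<Rightarrow> 'a \<Rightarrow> 'a point \<Rightarrow> bool"
  where "parabola_sum Y x1 x2 x3 S \<longleftrightarrow>
    (if coeff Y 2 = 0 then S = Infinity
     else \<exists>x. g - Y ^ 2 = - ([:coeff Y 2:] ^ 2) * ([:- x1, 1:] * ([:- x2, 1:] * [:- x3, 1:])) * [:- x, 1:]
        \<and> S = Affine x (- poly Y x))"

lemma interpolates_rotate: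
  "interpolates Y x1 y1 x2 y2 x3 y3 \<Longrightarrow> interpolates Y x2 y2 x3 y3 x1 y1"
  unfolding interpolates_def by (simp only: mult_ac)

lemma parabola_sum_rotate:
  "parabola_sum Y x1 x2 x3 S \<Longrightarrow> parabola_sum Y x2 x3 x1 S"
  unfolding parabola_sum_def by (simp only: mult_ac)

text \<open>The cubic divides (Y - Y')(Y + Y'), and \<open>Y + Y'\<close> takes the nonzero values 2
  y_i at its roots. So it divides \<open>Y - Y'\<close>, whose degree is at most two.\<close>

lemma interpolates_unique:
  assumes "interpolates Y x1 y1 x2 y2 x3 y3" "interpolates Y' x1 y1 x2 y2 x3 y3"
    and "2 * y1 \<noteq> 0" "2 * y2 \<noteq> 0" "2 * y3 \<noteq> 0"
  shows "Y = Y'"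
proof -
  let ?B = "Y - Y'" and ?C = "Y + Y'"
  have C: "poly ?C x1 \<noteq> 0" "poly ?C x2 \<noteq> 0" "poly ?C x3 \<noteq> 0"
    using assms unfolding interpolates_def poly_add mult_2 by metis+
  have "[:- x1, 1:] * ([:- x2, 1:] * [:- x3, 1:]) dvd (g - Y' ^ 2) - (g - Y ^ 2)"
    using assms(1,2) unfolding interpolates_def by (blast intro: dvd_diff)
  also have "(g - Y' ^ 2) - (g - Y ^ 2) = ?B * ?C"
    by (simp add: algebra_simps power2_eq_square)
  finally have d1: "[:- x1, 1:] * ([:- x2, 1:] * [:- x3, 1:]) dvd ?B * ?C" .
  obtain B1 where B1: "?B = [:- x1, 1:] * B1" "[:- x2, 1:] * [:- x3, 1:] dvd B1 * ?C"
    using linear_factor_dvd_mult_cancel[OF d1 C(1)] by blast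
  obtain B2 where B2: "B1 = [:- x2, 1:] * B2" "[:- x3, 1:] dvd B2 * ?C"
    using linear_factor_dvd_mult_cancel[OF B1(2) C(2)] by blast
  have d3: "[:- x3, 1:] * 1 dvd B2 * ?C"
    using B2(2) by simp
  obtain B3 where B3: "B2 = [:- x3, 1:] * B3"
    using linear_factor_dvd_mult_cancel[OF d3 C(3)] by blast
  have B: "?B = [:- x1, 1:] * ([:- x2, 1:] * ([:- x3, 1:] * B3))"
    using B1(1) B2(1) B3 by simp
  have "B3 = 0"
  proof (rule ccontr)
    assume "B3 \<noteq> 0"
    then have "degree ?B = 3 + degree B3"
      unfolding B by (simp add: degree_mult_eq)
    moreover have "degree ?B \<le> 2"
      using assms(1,2) by (intro degree_diff_le) (auto simp: interpolates_def)
    ultimately show False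
      by simp
  qed
  then show ?thesis
    using B by simp
qed

lemma parabola_sum_unique:
  assumes "parabola_sum Y x1 x2 x3 S" "parabola_sum Y x1 x2 x3 S'"
  shows "S = S'"
proof (cases "coeff Y 2 = 0")
  case True
  then show ?thesis
    using assms by (simp add: parabola_sum_def)
next
  case False
  let ?D = "- ([:coeff Y 2:] ^ 2) * ([:- x1, 1:] * ([:- x2, 1:] * [:- x3, 1:]))"
  obtain x x' where x: "g - Y ^ 2 = ?D * [:- x, 1:]" "S = Affine x (- poly Y x)"
    and x': "g - Y ^ 2 = ?D * [:- x', 1:]" "S' = Affine x' (- poly Y x')"
    using assms False by (auto simp: parabola_sum_def)
  have "?D \<noteq> 0"
    using False by simp
  then have "[:- x, 1:] = [:- x', 1:]"
    using x(1) x'(1) by (metis mult_left_cancel)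
  then show ?thesis
    using x(2) x'(2) by simp
qed

text \<open>\<open>l\<close> is the line through P and Q, \<open>V\<close> the product of their
  linear factors, \<open>w\<close> the factor of the third intersection. The second line passes
  through the reflected third point, hence has the form \<open>- l + K * w\<close>; the two
  factorizations of \<open>G\<close> are compared.\<close>

lemma chord_composition_cofactor:
  fixes G l V w r s K :: "'b::comm_ring_1"
  assumes "G - l ^ 2 = V * w" "G - (- l + K * w) ^ 2 = w * r * s"
  shows "w * (V + 2 * K * l - K ^ 2 * w) = w * (r * s)"
proof -
  have "w * (V + 2 * K * l - K ^ 2 * w) = V * w + l ^ 2 - (- l + K * w) ^ 2"
    by (simp add: algebra_simps power2_eq_square)
  also have "\<dots> = w * r * s"
    unfolding assms(1)[symmetric] assms(2)[symmetric] by simp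
  finally show ?thesis
    by (simp only: mult.assoc)
qed

text \<open>The polynomials \<open>l + I * V\<close> agree with \<open>l\<close> modulo
  \<open>V\<close>, so they keep P and Q. The value 1/K of \<open>I\<close> makes the other two
  zeros those of the second line.\<close>

lemma parabola_residual:
  fixes G l V w r s K I :: "'b::comm_ring_1"
  assumes "G - l ^ 2 = V * w" "V + 2 * K * l - K ^ 2 * w = r * s" "K * I = 1"
  shows "G - (l + I * V) ^ 2 = - (I ^ 2) * (V * r * s)"
proof -
  have "- (I ^ 2) * (V * r * s) = - (I ^ 2) * V * (V + 2 * K * l - K ^ 2 * w)"
    unfolding assms(2) by (simp add: mult.assoc)
  also have "\<dots> = - (I ^ 2) * V ^ 2 - 2 * (K * I) * I * l * V + (K * I) ^ 2 * (V * w)"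
    by (simp add: algebra_simps power2_eq_square)
  also have "\<dots> = G - (l + I * V) ^ 2"
    unfolding assms(3) assms(1)[symmetric] by (simp add: algebra_simps power2_eq_square)
  finally show ?thesis ..
qed

lemma parabola_exists:
  assumes on: "y1 ^ 2 = poly g x1" "y2 ^ 2 = poly g x2" "y3 ^ 2 = poly g x3"
    and n12: "x1 = x2 \<Longrightarrow> y1 \<noteq> - y2" and n13: "x1 = x3 \<Longrightarrow> y1 \<noteq> - y3"
    and n23: "x2 = x3 \<Longrightarrow> y2 \<noteq> - y3" and two: "(2::'a) \<noteq> 0"
  obtains Y where "interpolates Y x1 y1 x2 y2 x3 y3"
    "parabola_sum Y x1 x2 x3
      (chord_tangent g (chord_tangent g (Affine x1 y1) (Affine x2 y2)) (Affine x3 y3))"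
proof -
  obtain c1 m1 x12 where l1: "g - [:c1, m1:] ^ 2 = [:- x1, 1:] * [:- x2, 1:] * [:- x12, 1:]"
    "y1 = poly [:c1, m1:] x1" "y2 = poly [:c1, m1:] x2"
    "chord_tangent g (Affine x1 y1) (Affine x2 y2) = Affine x12 (- poly [:c1, m1:] x12)"
    using chord_exists[OF on(1,2) n12 two] by blast
  show thesis
  proof (cases "x12 = x3 \<and> - poly [:c1, m1:] x12 = - y3")
    \<comment> \<open>The chord meets the curve again in the third point itself, so the line is the
      degenerate parabola and the sum is \<open>Infinity\<close>.\<close>
    case True
    then have x12: "x12 = x3" "poly [:c1, m1:] x3 = y3"
      by (metis neg_equal_iff_equal)+
    have "degree [:c1, m1:] \<le> 2"
      by simp
    then have "interpolates [:c1, m1:] x1 y1 x2 y2 x3 y3"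
      unfolding interpolates_def l1(1) x12 using l1(2,3) by (simp only: mult.assoc) simp
    moreover have "parabola_sum [:c1, m1:] x1 x2 x3
      (chord_tangent g (chord_tangent g (Affine x1 y1) (Affine x2 y2)) (Affine x3 y3))"
      unfolding parabola_sum_def l1(4) x12 by (simp add: numeral_2_eq_2)
    ultimately show thesis
      using that by blast
  next
    case False
    have "(- poly [:c1, m1:] x12) ^ 2 = poly g x12"
      using arg_cong[OF l1(1), of "\<lambda>p. poly p x12"] by (simp add: poly_power power2_eq_square algebra_simps)
    then obtain c2 m2 x where l2: "g - [:c2, m2:] ^ 2 = [:- x12, 1:] * [:- x3, 1:] * [:- x, 1:]"
      "- poly [:c1, m1:] x12 = poly [:c2, m2:] x12" "y3 = poly [:c2, m2:] x3"
      "chord_tangent g (Affine x12 (- poly [:c1, m1:] x12)) (Affine x3 y3) =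
        Affine x (- poly [:c2, m2:] x)"
      using chord_exists[OF _ on(3) _ two, of "- poly [:c1, m1:] x12" x12] False by blast
    define k where "k = m1 + m2"
    define V where "V = [:- x1, 1:] * [:- x2, 1:]"
    have l12: "[:c2, m2:] = - [:c1, m1:] + [:k:] * [:- x12, 1:]"
      using l2(2) by (simp add: k_def algebra_simps mult_pCons_left)
    have V3: "V + 2 * [:k:] * [:c1, m1:] - [:k:] ^ 2 * [:- x12, 1:] = [:- x3, 1:] * [:- x, 1:]"
    proof -
      have "[:- x12, 1:] * (V + 2 * [:k:] * [:c1, m1:] - [:k:] ^ 2 * [:- x12, 1:]) =
        [:- x12, 1:] * ([:- x3, 1:] * [:- x, 1:])"
        using chord_composition_cofactor[OF l1(1)] l2(1) unfolding l12 V_def by blast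
      then show ?thesis
        by (metis mult_left_cancel pCons_eq_0_iff zero_neq_one)
    qed
    \<comment> \<open>For \<open>k = 0\<close> the second line would be the reflection of the first,
      and the third point would be the negative of one of the other two.\<close>
    have k0: "k \<noteq> 0"
    proof
      assume k: "k = 0"
      then have "V = [:- x3, 1:] * [:- x, 1:]"
        using V3 by simp
      then have "poly V x3 = 0"
        by simp
      then have "x3 = x1 \<or> x3 = x2"
        by (auto simp: V_def)
      moreover have "y3 = - poly [:c1, m1:] x3"
        using l2(3) l12 k by simp
      ultimately show False
        using n13 n23 l1(2,3) by auto
    qed
    define Y where "Y = [:c1, m1:] + [:1 / k:] * V"
    have c2: "coeff Y 2 = 1 / k"
      by (simp add: Y_def V_def numeral_2_eq_2 mult_pCons_left)
    have gY: "g - Y ^ 2 = - ([:1 / k:] ^ 2) * (V * [:- x3, 1:] * [:- x, 1:])"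
    proof -
      have "[:k:] * [:1 / k:] = 1"
        using k0 by (simp add: one_pCons mult_pCons_left)
      then show ?thesis
        using parabola_residual[OF l1(1)] V3 unfolding Y_def V_def by blast
    qed
    have Yv: "poly Y t = poly [:c2, m2:] t" if "t = x3 \<or> t = x" for t
    proof -
      have "poly V t + 2 * k * poly [:c1, m1:] t - k ^ 2 * (t - x12) = 0"
        using arg_cong[OF V3, of "\<lambda>p. poly p t"] that by (auto simp: poly_power)
      then have "poly V t = k ^ 2 * (t - x12) - 2 * k * poly [:c1, m1:] t"
        by (simp add: algebra_simps)
      then have "poly Y t = poly [:c1, m1:] t + (1 / k) * (k ^ 2 * (t - x12) - 2 * k * poly [:c1, m1:] t)"
        by (simp only: Y_def poly_add poly_mult) simp
      also have "\<dots> = - poly [:c1, m1:] t + k * (t - x12)"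
        using k0 by (simp add: field_simps power2_eq_square)
      finally show ?thesis
        unfolding l12 by simp
    qed
    have "degree Y \<le> 2"
      unfolding Y_def V_def by (simp add: mult_pCons_left)
    moreover have "poly Y x1 = y1" "poly Y x2 = y2"
      by (simp_all add: Y_def V_def l1(2,3))
    moreover have "poly Y x3 = y3"
      using Yv l2(3) by simp
    moreover have "[:- x1, 1:] * ([:- x2, 1:] * [:- x3, 1:]) dvd g - Y ^ 2"
      unfolding gY V_def by (intro dvdI[of _ _ "- ([:1 / k:] ^ 2) * [:- x, 1:]"]) (simp add: mult_ac)
    ultimately have "interpolates Y x1 y1 x2 y2 x3 y3"
      by (simp add: interpolates_def)
    moreover have "parabola_sum Y x1 x2 x3
      (chord_tangent g (chord_tangent g (Affine x1 y1) (Affine x2 y2)) (Affine x3 y3))"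
      unfolding parabola_sum_def l1(4) l2(4) using gY c2 k0 Yv
      by (auto simp: V_def mult.assoc)
    ultimately show thesis
      by (rule that)
  qed
qed

end

text \<open>A cubic without roots in \<open>L\<close> gives a curve without \<open>L\<close>-rational points of order two:
  ordinates never vanish, so the tangent at an \<open>L\<close>-rational point is never vertical.\<close>

locale rational_cubic_curve = cubic_curve g0 g1 g2 g
  for g0 g1 g2 :: "'a::field" and g +
  fixes L :: "'a set"
  assumes two: "(2::'a) \<noteq> 0"
    and L_1: "1 \<in> L"
    and L_uminus: "x \<in> L \<Longrightarrow> - x \<in> L"
    and L_add: "x \<in> L \<Longrightarrow> y \<in> L \<Longrightarrow> x + y \<in> L"
    and L_mult: "x \<in> L \<Longrightarrow> y \<in> L \<Longrightarrow> x * y \<in> L"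
    and L_inverse: "x \<in> L \<Longrightarrow> inverse x \<in> L"
    and L_coeffs: "g0 \<in> L" "g1 \<in> L" "g2 \<in> L"
    and no_root: "x \<in> L \<Longrightarrow> poly g x \<noteq> 0"
begin

section \<open>Group axioms for the rational points\<close>

abbreviation E where "E \<equiv> elliptic_curve_group L g"
abbreviation pt_add (infixl "\<boxplus>" 65) where "pt_add \<equiv> chord_tangent g"

lemma L_diff: "x \<in> L \<Longrightarrow> y \<in> L \<Longrightarrow> x - y \<in> L"
  using L_add[of x "- y"] L_uminus by simp

lemma L_divide: "x \<in> L \<Longrightarrow> y \<in> L \<Longrightarrow> x / y \<in> L"
  by (simp add: divide_inverse L_mult L_inverse)

lemma Affine_in_carrier [simp]: "Affine x y \<in> carrier E \<longleftrightarrow> x \<in> L \<and> y \<in> L \<and> y ^ 2 = poly g x"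
  by (auto simp: elliptic_curve_group_def)

lemma Infinity_in_carrier [simp]: "Infinity \<in> carrier E"
  by (simp add: elliptic_curve_group_def)

lemma E_mult [simp]: "monoid.mult E = chord_tangent g" and E_one [simp]: "monoid.one E = Infinity"
  by (simp_all add: elliptic_curve_group_def)

lemma ordinate_nonzero: "Affine x y \<in> carrier E \<Longrightarrow> 2 * y \<noteq> 0"
  using no_root[of x] two by auto

lemma point_neg_closed: "P \<in> carrier E \<Longrightarrow> point_neg P \<in> carrier E"
  by (cases P) (auto simp: L_uminus)

lemma Infinity_add_right [simp]: "P \<boxplus> Infinity = P"
  by (cases P) auto

lemma add_point_neg [simp]: "P \<boxplus> point_neg P = Infinity"
  by (cases P) auto

lemma point_neg_add [simp]: "point_neg P \<boxplus> P = Infinity"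
  by (cases P) auto

lemma add_closed:
  assumes "P \<in> carrier E" "Q \<in> carrier E"
  shows "P \<boxplus> Q \<in> carrier E"
proof (cases "P = Infinity \<or> Q = Infinity \<or> Q = point_neg P")
  case True
  then show ?thesis
    using assms by auto
next
  case False
  then obtain x1 y1 x2 y2 where PQ: "P = Affine x1 y1" "Q = Affine x2 y2"
    by (meson point_neg.cases)
  then have n: "x1 = x2 \<Longrightarrow> y1 \<noteq> - y2"
    using False by auto
  define m where "m = (if x1 = x2 then poly (pderiv g) x1 / (2 * y1) else (y2 - y1) / (x2 - x1))"
  define x3 where "x3 = m ^ 2 - g2 - x1 - x2"
  have eq: "P \<boxplus> Q = Affine x3 (- (y1 + m * (x3 - x1)))"
    unfolding PQ using n by (intro chord_tangent_Affine[OF _ m_def]) (auto simp: x3_def g_def numeral_2_eq_2)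
  have coords: "x1 \<in> L" "y1 \<in> L" "x2 \<in> L" "y2 \<in> L" "y1 ^ 2 = poly g x1" "y2 ^ 2 = poly g x2"
    using assms PQ by auto
  have L2: "2 \<in> L"
    using L_add[OF L_1 L_1] by simp
  have L3: "3 \<in> L"
    using L_add[OF L2 L_1] by simp
  have "poly (pderiv g) x1 \<in> L"
    using coords L_coeffs L2 L3 by (simp add: g_def pderiv_pCons L_add L_mult)
  then have "poly (pderiv g) x1 / (2 * y1) \<in> L" "(y2 - y1) / (x2 - x1) \<in> L"
    using coords L2 by (simp_all add: L_divide L_diff L_mult)
  then have mL: "m \<in> L"
    unfolding m_def by auto
  then have x3L: "x3 \<in> L"
    using coords L_coeffs by (simp add: x3_def power2_eq_square L_diff L_mult)
  obtain c' m' x3' where l: "g - [:c', m':] ^ 2 = [:- x1, 1:] * [:- x2, 1:] * [:- x3', 1:]"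
    "P \<boxplus> Q = Affine x3' (- poly [:c', m':] x3')"
    using chord_exists[OF coords(5,6) n two] PQ by metis
  have "(- poly [:c', m':] x3') ^ 2 = poly g x3'"
    using arg_cong[OF l(1), of "\<lambda>p. poly p x3'"]
    by (simp add: poly_power power2_eq_square algebra_simps)
  then have "(- (y1 + m * (x3 - x1))) ^ 2 = poly g x3"
    using l(2) eq by (metis point.inject)
  then show ?thesis
    using eq coords mL x3L by (simp add: L_add L_mult L_diff L_uminus)
qed

lemma add_commute:
  assumes "P \<in> carrier E" "Q \<in> carrier E"
  shows "P \<boxplus> Q = Q \<boxplus> P"
proof (cases "P = Infinity \<or> Q = Infinity \<or> Q = point_neg P")
  case True
  then show ?thesis
    by auto
next
  case False
  then obtain x1 y1 x2 y2 where PQ: "P = Affine x1 y1" "Q = Affine x2 y2"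
    by (meson point_neg.cases)
  then have n: "x1 = x2 \<Longrightarrow> y1 \<noteq> - y2"
    using False by auto
  have on: "y1 ^ 2 = poly g x1" "y2 ^ 2 = poly g x2"
    using assms PQ by auto
  obtain c m x3 where l: "g - [:c, m:] ^ 2 = [:- x1, 1:] * [:- x2, 1:] * [:- x3, 1:]"
    "y1 = poly [:c, m:] x1" "y2 = poly [:c, m:] x2" "P \<boxplus> Q = Affine x3 (- poly [:c, m:] x3)"
    using chord_exists[OF on n two] PQ by metis
  have "g - [:c, m:] ^ 2 = [:- x2, 1:] * [:- x1, 1:] * [:- x3, 1:]"
    using l(1) by (simp only: mult_ac)
  moreover have "x2 = x1 \<Longrightarrow> 2 * poly [:c, m:] x2 \<noteq> 0"
    using ordinate_nonzero assms(2) l(3) PQ(2) by metis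
  ultimately have "Q \<boxplus> P = Affine x3 (- poly [:c, m:] x3)"
    unfolding PQ l(2,3) by (rule chord_unique)
  then show ?thesis
    using l(4) by simp
qed

text \<open>The reflected chord passes through the negatives of P and Q and through P + Q. This
  settles associativity when two of the three points are opposite, where
  \<open>parabola_exists\<close> does not apply.\<close>

lemma neg_add_cancel:
  assumes "P \<in> carrier E" "Q \<in> carrier E"
  shows "point_neg P \<boxplus> (P \<boxplus> Q) = Q"
proof (cases "P = Infinity \<or> Q = Infinity \<or> Q = point_neg P")
  case True
  then show ?thesis
    by auto
next
  case False
  then obtain x1 y1 x2 y2 where PQ: "P = Affine x1 y1" "Q = Affine x2 y2"
    by (meson point_neg.cases)
  then have n: "x1 = x2 \<Longrightarrow> y1 \<noteq> - y2"
    using False by auto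
  have on: "y1 ^ 2 = poly g x1" "y2 ^ 2 = poly g x2"
    using assms PQ by auto
  obtain c m x3 where l: "g - [:c, m:] ^ 2 = [:- x1, 1:] * [:- x2, 1:] * [:- x3, 1:]"
    "y1 = poly [:c, m:] x1" "y2 = poly [:c, m:] x2" "P \<boxplus> Q = Affine x3 (- poly [:c, m:] x3)"
    using chord_exists[OF on n two] PQ by metis
  have neg: "- poly [:c, m:] t = poly [:- c, - m:] t" for t
    by simp
  have "[:- c, - m:] ^ 2 = [:c, m:] ^ 2"
    using power2_minus[of "[:c, m:]"] by simp
  then have "g - [:- c, - m:] ^ 2 = [:- x1, 1:] * [:- x3, 1:] * [:- x2, 1:]"
    using l(1) by (simp only: mult_ac)
  moreover have "x1 = x3 \<Longrightarrow> 2 * poly [:- c, - m:] x1 \<noteq> 0"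
    using ordinate_nonzero[of x1 y1] assms(1) PQ(1)
    unfolding neg[symmetric] l(2)[symmetric] mult_minus_right neg_equal_0_iff_equal by blast
  ultimately have "Affine x1 (poly [:- c, - m:] x1) \<boxplus> Affine x3 (poly [:- c, - m:] x3) =
      Affine x2 (- poly [:- c, - m:] x2)"
    by (rule chord_unique)
  then have "Affine x1 (- y1) \<boxplus> Affine x3 (- poly [:c, m:] x3) = Affine x2 y2"
    by (simp only: neg[symmetric] l(2,3)[symmetric] minus_minus)
  then show ?thesis
    unfolding l(4) unfolding PQ point_neg.simps .
qed

lemma point_neg_neg [simp]: "point_neg (point_neg P) = P" for P :: "'a point"
  by (cases P) auto

lemma add_assoc:
  assumes P: "P \<in> carrier E" and Q: "Q \<in> carrier E" and R: "R \<in> carrier E"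
  shows "(P \<boxplus> Q) \<boxplus> R = P \<boxplus> (Q \<boxplus> R)"
proof -
  consider "P = Infinity \<or> Q = Infinity \<or> R = Infinity" | "P = point_neg Q" | "R = point_neg Q"
    | "R = point_neg P"
    | x1 y1 x2 y2 x3 y3 where "P = Affine x1 y1" "Q = Affine x2 y2" "R = Affine x3 y3"
      "P \<noteq> point_neg Q" "R \<noteq> point_neg Q" "R \<noteq> point_neg P"
    by (metis point.exhaust)
  then show ?thesis
  proof cases
    case 1
    then show ?thesis by auto
  next
    case 2
    then show ?thesis
      using neg_add_cancel[OF Q R] by simp
  next
    case 3
    have "point_neg Q \<boxplus> (Q \<boxplus> P) = P"
      by (rule neg_add_cancel[OF Q P])
    then show ?thesis
      using 3 P Q by (simp add: add_commute[OF P Q] add_commute[OF add_closed[OF Q P] point_neg_closed[OF Q]])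
  next
    case 4
    have "point_neg P \<boxplus> (P \<boxplus> Q) = Q"
      by (rule neg_add_cancel[OF P Q])
    moreover have "P \<boxplus> (point_neg P \<boxplus> Q) = Q"
      using neg_add_cancel[OF point_neg_closed[OF P] Q] by simp
    ultimately show ?thesis
      using 4 add_commute[OF add_closed[OF P Q] R] add_commute[OF Q R] by simp
  next
    case 5
    have on: "y1 ^ 2 = poly g x1" "y2 ^ 2 = poly g x2" "y3 ^ 2 = poly g x3"
      using P Q R 5 by auto
    have y: "2 * y1 \<noteq> 0" "2 * y2 \<noteq> 0" "2 * y3 \<noteq> 0"
      using P Q R ordinate_nonzero unfolding 5 by blast+
    have n: "x1 = x2 \<Longrightarrow> y1 \<noteq> - y2" "x1 = x3 \<Longrightarrow> y1 \<noteq> - y3" "x2 = x3 \<Longrightarrow> y2 \<noteq> - y3"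
      and n': "x2 = x1 \<Longrightarrow> y2 \<noteq> - y1" "x3 = x1 \<Longrightarrow> y3 \<noteq> - y1"
      using 5 by auto
    obtain Y where Y: "interpolates Y x1 y1 x2 y2 x3 y3"
      "parabola_sum Y x1 x2 x3 ((P \<boxplus> Q) \<boxplus> R)"
      using parabola_exists[OF on n two] unfolding 5 by blast
    \<comment> \<open>For the cyclic shift the same construction yields (Q + R) + P; uniqueness of
      the parabola identifies the two sums.\<close>
    obtain Y' where Y': "interpolates Y' x2 y2 x3 y3 x1 y1"
      "parabola_sum Y' x2 x3 x1 ((Q \<boxplus> R) \<boxplus> P)"
      using parabola_exists[OF on(2,3,1) n(3) n'(1,2) two] unfolding 5 by blast
    have "Y = Y'"
      using interpolates_unique[OF interpolates_rotate[OF Y(1)] Y'(1)] y by simp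
    then have "(P \<boxplus> Q) \<boxplus> R = (Q \<boxplus> R) \<boxplus> P"
      using parabola_sum_unique[OF parabola_sum_rotate[OF Y(2)]] Y'(2) by simp
    then show ?thesis
      using add_commute[OF P add_closed[OF Q R]] by simp
  qed
qed

lemma comm_group_E: "comm_group E"
proof (rule comm_groupI)
  show "\<exists>Q \<in> carrier E. Q \<otimes>\<^bsub>E\<^esub> P = \<one>\<^bsub>E\<^esub>" if "P \<in> carrier E" for P
    using point_neg_closed[OF that] by (intro bexI[of _ "point_neg P"]) simp_all
qed (simp_all add: add_closed add_assoc, rule add_commute)

lemma inv_E: "P \<in> carrier E \<Longrightarrow> inv\<^bsub>E\<^esub> P = point_neg P"
  using group.inv_equality[OF comm_group.axioms(2)[OF comm_group_E], of "point_neg P" P]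
  by (simp add: point_neg_closed)

lemma no_2_torsion:
  assumes "P \<in> carrier E" "P \<boxplus> P = Infinity"
  shows "P = Infinity"
proof (cases P)
  case (Affine x y)
  then have "y = - y"
    using assms by (auto simp: Let_def split: if_splits)
  then have "2 * y = 0"
    by (metis add.right_inverse mult_2)
  then show ?thesis
    using assms(1) ordinate_nonzero Affine by blast
qed

end

section \<open>Reduction to the Klein four-group\<close>

text \<open>The sets \<open>C i j\<close> play the role of the fibres of a homomorphism to the Klein four-group
  that sends \<open>p\<close> and \<open>q\<close> to generators.\<close>

lemma (in comm_group) independent_of_parity:
  fixes C :: "bool \<Rightarrow> bool \<Rightarrow> 'a set"
  assumes p: "p \<in> carrier G" and q: "q \<in> carrier G"
    and C0: "\<one> \<in> C False False" and C1: "\<And>i j. \<one> \<in> C i j \<Longrightarrow> \<not> i \<and> \<not> j"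
    and stepp: "\<And>x i j p'. p' \<in> {p, inv p} \<Longrightarrow> x \<in> carrier G \<Longrightarrow> x \<in> C i j \<Longrightarrow> p' \<otimes> x \<in> C (\<not> i) j"
    and stepq: "\<And>x i j q'. q' \<in> {q, inv q} \<Longrightarrow> x \<in> carrier G \<Longrightarrow> x \<in> C i j \<Longrightarrow> q' \<otimes> x \<in> C i (\<not> j)"
    and no2: "\<And>x. x \<in> carrier G \<Longrightarrow> x \<otimes> x = \<one> \<Longrightarrow> x = \<one>"
    and eq: "p [^] (a::int) \<otimes> q [^] (b::int) = \<one>"
  shows "a = 0 \<and> b = 0"
proof -
  have swap: "(u \<otimes> v) \<otimes> (u \<otimes> v) = (u \<otimes> u) \<otimes> (v \<otimes> v)"
    if "u \<in> carrier G" "v \<in> carrier G" for u v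
    using that by (metis m_assoc m_comm m_closed)
  have shift: "z [^] (k + 1) = z \<otimes> z [^] k" "z [^] (k - 1) = inv z \<otimes> z [^] k"
    if "z \<in> carrier G" for z and k :: int
  proof -
    show "z [^] (k + 1) = z \<otimes> z [^] k"
      using int_pow_mult[OF that, of 1 k] that by (simp add: add.commute)
    show "z [^] (k - 1) = inv z \<otimes> z [^] k"
      using int_pow_mult[OF that, of "-1" k] that by (simp add: int_pow_neg)
  qed
  have Cq: "q [^] k \<in> C False (odd k)" for k :: int
  proof (induction k rule: int_induct[where k = 0])
    case base
    then show ?case using C0 by simp
  next
    case (step1 k)
    then show ?case
      using stepq[of q "q [^] k" False "odd k"] q by (simp add: shift[OF q])
  next
    case (step2 k)
    then show ?case
      using stepq[of "inv q" "q [^] k" False "odd k"] q by (simp add: shift[OF q])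
  qed
  have Cpq: "p [^] k \<otimes> q [^] l \<in> C (odd k) (odd l)" for k l :: int
  proof (induction k rule: int_induct[where k = 0])
    case base
    then show ?case using Cq q by simp
  next
    case (step1 k)
    then show ?case
      using stepp[of p "p [^] k \<otimes> q [^] l" "odd k" "odd l"] p q by (simp add: shift[OF p] m_assoc)
  next
    case (step2 k)
    then show ?case
      using stepp[of "inv p" "p [^] k \<otimes> q [^] l" "odd k" "odd l"] p q by (simp add: shift[OF p] m_assoc)
  qed
  show ?thesis
    using eq
  proof (induction "nat \<bar>a\<bar> + nat \<bar>b\<bar>" arbitrary: a b rule: less_induct)
    case less
    have "even a" "even b"
      using Cpq[of a b] C1 less.prems by auto
    then obtain a' b' where ab: "a = a' + a'" "b = b' + b'"
      by (metis evenE mult_2)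
    let ?x = "p [^] a' \<otimes> q [^] b'"
    have x: "?x \<in> carrier G"
      using p q by simp
    have "?x \<otimes> ?x = p [^] a \<otimes> q [^] b"
      using swap[of "p [^] a'" "q [^] b'"] p q by (simp add: ab(1,2) int_pow_mult[symmetric])
    then have "?x \<otimes> ?x = \<one>"
      using less.prems by simp
    then have "?x = \<one>"
      by (rule no2[OF x])
    \<comment> \<open>Halving lowers the measure strictly unless both exponents are already
      zero.\<close>
    moreover have "nat \<bar>a'\<bar> + nat \<bar>b'\<bar> < nat \<bar>a\<bar> + nat \<bar>b\<bar> \<or> a' = 0 \<and> b' = 0"
      unfolding ab by linarith
    ultimately have "a' = 0 \<and> b' = 0"
      using less.hyps by blast
    then show ?case
      by (simp add: ab)
  qed
qed

lemma (in comm_group) group_rank_ge_2: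
  assumes p: "p \<in> carrier G" and q: "q \<in> carrier G" and "p \<noteq> q"
    and indep: "\<And>(a::int) (b::int). p [^] a \<otimes> q [^] b = \<one> \<Longrightarrow> a = 0 \<and> b = 0"
  shows "group_rank G \<ge> 2"
proof -
  have "Z_independent G {p, q}"
    unfolding Z_independent_def
  proof (intro allI impI)
    fix c :: "'a \<Rightarrow> int"
    assume "(\<Otimes>x\<in>{p, q}. x [^] c x) = \<one>"
    then have "p [^] c p \<otimes> q [^] c q = \<one>"
      using p q \<open>p \<noteq> q\<close> by (simp add: finprod_insert)
    then show "\<forall>x\<in>{p, q}. c x = 0"
      using indep by simp
  qed
  then have "enat (card {p, q}) \<le> group_rank G"
    unfolding group_rank_def using p q by (intro SUP_upper) auto
  moreover have "card {p, q} = 2"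
    using \<open>p \<noteq> q\<close> by simp
  ultimately show ?thesis
    by (simp only: numeral_eq_enat)
qed

section \<open>Integrality in a valuation ring\<close>

locale valuation_ring =
  fixes V M :: "'a::field set"
  assumes V: "is_subring V" and M: "is_ideal V M" and one_notin_M: "1 \<notin> M"
    and inverse_mem_M: "x \<notin> V \<Longrightarrow> inverse x \<in> M"
    and inverse_mem_V: "x \<in> V \<Longrightarrow> x \<notin> M \<Longrightarrow> inverse x \<in> V"
begin

lemmas V_closed = subring_1[OF V] subring_0[OF V] subring_add[OF V] subring_diff[OF V]
  subring_mult[OF V] subring_uminus[OF V] subring_power[OF V]

lemmas M_closed = ideal_0[OF M] ideal_add[OF M] ideal_diff[OF V M] ideal_uminus[OF V M]

lemma M_V: "x \<in> M \<Longrightarrow> x \<in> V"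
  by (rule ideal_subset[OF M])

lemma M_mult_left: "x \<in> V \<Longrightarrow> y \<in> M \<Longrightarrow> x * y \<in> M"
  by (rule ideal_mult[OF M])

lemma M_mult_right: "x \<in> M \<Longrightarrow> y \<in> V \<Longrightarrow> x * y \<in> M"
  using M_mult_left[of y x] by (simp add: mult.commute)

lemma M_prime: "x \<in> V \<Longrightarrow> x * y \<in> M \<Longrightarrow> x \<in> M \<or> y \<in> M"
  using M_mult_left[OF inverse_mem_V, of x "x * y"] M_closed(1)
  by (cases "x = 0") (auto simp: mult.assoc[symmetric])

lemma square_mem_V: "x ^ 2 \<in> V \<Longrightarrow> x \<in> V"
proof (rule ccontr)
  assume "x ^ 2 \<in> V" "x \<notin> V"
  then have "x ^ 2 * (inverse x * inverse x) \<in> M" "x \<noteq> 0"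
    using inverse_mem_M M_V M_mult_left V_closed(2) by blast+
  moreover have "x ^ 2 * (inverse x * inverse x) = (x * inverse x) ^ 2"
    by (simp only: power2_eq_square mult_ac)
  ultimately show False
    using one_notin_M by (metis right_inverse power_one)
qed

lemma square_mem_M: "x ^ 2 \<in> M \<Longrightarrow> x \<in> M"
  using M_prime[of x x] square_mem_V[of x] M_V by (auto simp: power2_eq_square)

text \<open>Integral closedness in degree two: if \<open>n\<close> had a pole, dividing the equation
  by n^2 would put 1 into \<open>M\<close>.\<close>

lemma root_of_monic_quadratic_mem_V:
  assumes "n ^ 2 + b * n = c" "b \<in> V" "c \<in> V"
  shows "n \<in> V"
proof (rule ccontr)
  assume n: "n \<notin> V"
  then have i: "inverse n \<in> M" and "n \<noteq> 0"
    using inverse_mem_M V_closed(2) by blast+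
  then have "1 = c * inverse n * inverse n - b * inverse n"
    unfolding assms(1)[symmetric] by (simp add: power2_eq_square algebra_simps)
  also have "\<dots> \<in> M"
    by (rule M_closed(3)[OF M_mult_left[OF V_closed(5)[OF assms(3) M_V[OF i]] i]
          M_mult_left[OF assms(2) i]])
  finally show False
    using one_notin_M by blast
qed

end

text \<open>The prime ideal \<open>M\<close> is a place of good reduction where \<open>Y\<^sup>2 = (X - r) (X - s) (X - t) + d\<^sup>2\<close>
  acquires full two-torsion. The points reducing to the neutral element are \<open>fiber_inf\<close>, those
  reducing to \<open>(r, 0)\<close> are \<open>fiber r\<close>.\<close>

locale reduction = rational_cubic_curve g0 g1 g2 g L + valuation_ring V M
  for g0 g1 g2 :: "'a::field" and g and L V M :: "'a set"
begin

definition fiber_inf :: "'a point set"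
  where "fiber_inf = insert Infinity {Affine x y | x y. x \<notin> V}"

text \<open>The abscissa decides alone: under \<open>splits_mod\<close>,
  \<open>fiber_ordinate_in_M\<close> then forces the ordinate of a point of the curve into
  \<open>M\<close>.\<close>

definition fiber :: "'a \<Rightarrow> 'a point set"
  where "fiber r = {Affine x y | x y. x - r \<in> M}"

text \<open>Invariant under permuting the roots and under changing the sign of \<open>d\<close>, so
  what is proved for the first root holds for all six points.\<close>

definition splits_mod :: "'a \<Rightarrow> 'a \<Rightarrow> 'a \<Rightarrow> 'a \<Rightarrow> bool"
  where "splits_mod r s t d \<longleftrightarrow>
    g = [:- r, 1:] * [:- s, 1:] * [:- t, 1:] + [:d ^ 2:] \<and>
    r \<in> V \<and> s \<in> V \<and> t \<in> V \<and> r \<in> L \<and> s \<in> L \<and> t \<in> L \<and> d \<in> L \<and> d \<in> M \<and>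
    2 \<notin> M \<and> r - s \<notin> M \<and> r - t \<notin> M \<and> s - t \<notin> M"

section \<open>Translation by a root point\<close>

lemma splits_mod_swap12: "splits_mod r s t d \<Longrightarrow> splits_mod s r t d"
  and splits_mod_swap23: "splits_mod r s t d \<Longrightarrow> splits_mod r t s d"
  and splits_mod_neg: "splits_mod r s t d \<Longrightarrow> splits_mod r s t (- d)"
  using M_closed(4)[of "s - r"] M_closed(4)[of "t - r"] M_closed(4)[of "t - s"]
  unfolding splits_mod_def by (auto simp: mult_ac L_uminus M_closed(4))

lemma poly_g: "splits_mod r s t d \<Longrightarrow> poly g x = (x - r) * (x - s) * (x - t) + d ^ 2"
  by (simp add: splits_mod_def)

lemma root_point_in_carrier: "splits_mod r s t d \<Longrightarrow> Affine r d \<in> carrier E"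
  by (simp add: poly_g) (simp add: splits_mod_def)

text \<open>The last equation says that the slope is (x - s)(x - t)/(y + d): the factor x - r of y^2
  - d^2 has been cancelled, so chord and tangent are covered alike.\<close>

lemma add_root_point:
  assumes g: "splits_mod r s t d" and Q: "Affine x y \<in> carrier E" and ne: "x = r \<Longrightarrow> y \<noteq> - d"
  obtains m x3 y3 where "Affine r d \<boxplus> Affine x y = Affine x3 y3" "x3 = m ^ 2 + s + t - x"
    "m * (x - r) = y - d" "m * (2 * d + m * (x - r)) = (x - s) * (x - t)"
proof -
  have g2: "coeff g 2 = - (r + s + t)" and g': "poly (pderiv g) r = (r - s) * (r - t)"
    using g unfolding splits_mod_def
    by (simp_all add: numeral_2_eq_2 pderiv_pCons mult_pCons_left algebra_simps)
  define m where "m = (if r = x then poly (pderiv g) r / (2 * d) else (y - d) / (x - r))"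
  define x3 where "x3 = m ^ 2 - coeff g 2 - r - x"
  have "r = x \<Longrightarrow> d \<noteq> - y"
    using ne by auto
  then have eq: "Affine r d \<boxplus> Affine x y = Affine x3 (- (d + m * (x3 - r)))"
    by (rule chord_tangent_Affine[OF _ m_def x3_def])
  have y: "y ^ 2 = (x - r) * (x - s) * (x - t) + d ^ 2"
    using Q by (simp add: poly_g[OF g])
  have 1: "m * (x - r) = y - d"
  proof (cases "r = x")
    case True
    then have "(y - d) * (y + d) = 0"
      using y by (simp add: algebra_simps power2_eq_square)
    moreover have "y + d \<noteq> 0"
      using ne True by (metis eq_neg_iff_add_eq_0)
    ultimately show ?thesis
      using True by simp
  qed (simp add: m_def)
  have "m * (2 * d + m * (x - r)) = (x - s) * (x - t)"
  proof (cases "r = x")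
    case True
    moreover have "2 * d \<noteq> 0"
      using ordinate_nonzero[OF root_point_in_carrier[OF g]] .
    ultimately show ?thesis
      using g' by (simp add: m_def)
  next
    case False
    have y': "y = d + m * (x - r)"
      using 1 by simp
    have "(x - r) * (m * (2 * d + m * (x - r))) = (y - d) * (y + d)"
      unfolding y' by (simp add: algebra_simps)
    also have "\<dots> = (x - r) * ((x - s) * (x - t))"
      using y by (simp add: algebra_simps power2_eq_square)
    finally show ?thesis
      using False by simp
  qed
  then show thesis
    using that[OF eq _ 1] by (simp add: x3_def g2)
qed

text \<open>For d = 0 this is translation by the point of order two (r, 0), an involution of the
  abscissa that swaps \<open>r\<close> with infinity and \<open>s\<close> with \<open>t\<close>; the
  term 2md is the perturbation.\<close>

lemma shifted_abscissa_identity: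
  fixes m x d r s t :: 'a
  assumes "m * (2 * d + m * (x - r)) = (x - s) * (x - t)"
  shows "(x - r) * ((m ^ 2 + s + t - x) - r) = (r - s) * (r - t) - 2 * m * d"
proof -
  have "(x - r) * ((m ^ 2 + s + t - x) - r) =
      m * (2 * d + m * (x - r)) - 2 * m * d + (x - r) * (s + t - x - r)"
    by (simp add: algebra_simps power2_eq_square)
  then show ?thesis
    unfolding assms by (simp add: algebra_simps)
qed

lemma fiber_abscissa_in_V: "splits_mod r s t d \<Longrightarrow> x - r \<in> M \<Longrightarrow> x \<in> V"
  using M_V[of "x - r"] V_closed(3)[of "x - r" r] by (simp add: splits_mod_def)

lemma fiber_ordinate_in_M:
  assumes g: "splits_mod r s t d" and "Affine x y \<in> carrier E" "x - r \<in> M"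
  shows "y \<in> M"
proof -
  have V: "s \<in> V" "t \<in> V" "d \<in> M"
    using g by (auto simp: splits_mod_def)
  have x: "x \<in> V"
    by (rule fiber_abscissa_in_V[OF g assms(3)])
  have "(x - r) * ((x - s) * (x - t)) \<in> M"
    by (rule M_mult_right[OF assms(3) V_closed(5)[OF V_closed(4)[OF x V(1)] V_closed(4)[OF x V(2)]]])
  moreover have "d * d \<in> M"
    by (rule M_mult_left[OF M_V[OF V(3)] V(3)])
  moreover have "y ^ 2 = (x - r) * ((x - s) * (x - t)) + d * d"
    using assms(2) poly_g[OF g, of x] unfolding Affine_in_carrier by (simp only: power2_eq_square mult.assoc)
  ultimately show ?thesis
    using M_closed(2) square_mem_M by metis
qed

text \<open>The slope may have a pole, but \<open>n\<close>, the slope divided by x - r, is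
  integral. Multiplied by e = 1/(x - r), the perturbation 2md becomes 2nd, which lies in
  \<open>M\<close>.\<close>

lemma add_root_point_fiber_inf:
  assumes g: "splits_mod r s t d" and Q: "Q \<in> carrier E" "Q \<in> fiber_inf"
  shows "Affine r d \<boxplus> Q \<in> fiber r"
proof (cases "Q = Infinity")
  case True
  then show ?thesis
    by (simp add: fiber_def M_closed(1))
next
  case False
  then obtain x y where xy: "Q = Affine x y" "x \<notin> V"
    using Q(2) by (auto simp: fiber_inf_def)
  have V: "r \<in> V" "s \<in> V" "t \<in> V" "d \<in> M"
    using g by (auto simp: splits_mod_def)
  have xr: "x - r \<notin> V"
    using xy(2) V_closed(3)[of "x - r" r] V(1) by auto
  then have x0: "x - r \<noteq> 0"
    using V_closed(2) by metis
  obtain m x3 y3 where m: "Affine r d \<boxplus> Affine x y = Affine x3 y3" "x3 = m ^ 2 + s + t - x"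
    "m * (x - r) = y - d" "m * (2 * d + m * (x - r)) = (x - s) * (x - t)"
    by (rule add_root_point[OF g]) (use Q(1) xy x0 in auto)
  define e where "e = inverse (x - r)"
  have e: "e \<in> M" "e * (x - r) = 1"
    using inverse_mem_M[OF xr] x0 by (simp_all add: e_def)
  define n where "n = m * e"
  have mn: "m = n * (x - r)"
    using e(2) by (simp add: n_def mult.assoc)
  have es: "(x - s) * e = 1 + (r - s) * e" "(x - t) * e = 1 + (r - t) * e"
    using e(2) by (simp_all add: algebra_simps)
  \<comment> \<open>The slope relation times e^3, rewritten in terms of \<open>n\<close>.\<close>
  have "n ^ 2 + (2 * d * e * e) * n = e * e * e * (m * (2 * d + m * (x - r)))"
  proof -
    have "e * e * e * (m * (2 * d + m * (x - r))) =
        n ^ 2 * (e * (x - r)) ^ 3 + (2 * d * e * e) * n * (e * (x - r))"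
      unfolding mn by (simp add: algebra_simps power2_eq_square power3_eq_cube)
    then show ?thesis
      unfolding e(2) by simp
  qed
  also have "\<dots> = e * ((x - s) * e) * ((x - t) * e)"
    unfolding m(4) by (simp add: mult_ac)
  finally have "n ^ 2 + (2 * d * e * e) * n = e * (1 + (r - s) * e) * (1 + (r - t) * e)"
    unfolding es .
  then have nV: "n \<in> V"
  proof (rule root_of_monic_quadratic_mem_V)
    have "2 \<in> V"
      using V_closed(3)[OF V_closed(1) V_closed(1)] by simp
    then show "2 * d * e * e \<in> V" "e * (1 + (r - s) * e) * (1 + (r - t) * e) \<in> V"
      using V M_V[OF e(1)] M_V[OF V(4)] by (auto intro!: V_closed)
  qed
  have "x3 - r = e * (x - r) * (x3 - r)"
    using e(2) by simp
  also have "\<dots> = e * ((r - s) * (r - t) - 2 * m * d)"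
    unfolding m(2) mult.assoc using shifted_abscissa_identity[OF m(4)] by (simp add: mult.assoc)
  also have "\<dots> = (r - s) * (r - t) * e - (n * d + n * d)"
    by (simp add: n_def algebra_simps)
  also have "\<dots> \<in> M"
    using V nV e(1) by (intro M_closed(2,3) M_mult_left V_closed)
  finally show ?thesis
    using m(1) xy(1) by (simp add: fiber_def)
qed

text \<open>If the new abscissa were integral, so would be m^2 and hence \<open>m\<close>; then
  \<open>shifted_abscissa_identity\<close> would put (r - s)(r - t) into \<open>M\<close>.\<close>

lemma add_root_point_fiber_same:
  assumes g: "splits_mod r s t d" and Q: "Q \<in> carrier E" "Q \<in> fiber r"
  shows "Affine r d \<boxplus> Q \<in> fiber_inf"
proof -
  obtain x y where xy: "Q = Affine x y" "x - r \<in> M"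
    using Q(2) by (auto simp: fiber_def)
  show ?thesis
  proof (cases "x = r \<and> y = - d")
    case True
    then show ?thesis
      using xy(1) by (simp add: fiber_inf_def)
  next
    case False
    then have ne: "x = r \<Longrightarrow> y \<noteq> - d"
      by blast
    have Q': "Affine x y \<in> carrier E"
      using Q(1) unfolding xy(1) .
    obtain m x3 y3 where m: "Affine r d \<boxplus> Affine x y = Affine x3 y3" "x3 = m ^ 2 + s + t - x"
      "m * (x - r) = y - d" "m * (2 * d + m * (x - r)) = (x - s) * (x - t)"
      by (rule add_root_point[OF g Q' ne])
    have V: "r \<in> V" "s \<in> V" "t \<in> V" "d \<in> M" and n: "r - s \<notin> M" "r - t \<notin> M"
      using g by (auto simp: splits_mod_def)
    have x: "x \<in> V"
      by (rule fiber_abscissa_in_V[OF g xy(2)])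
    have "x3 \<notin> V"
    proof
      assume x3: "x3 \<in> V"
      have "x3 - s - t + x \<in> V"
        by (rule V_closed(3)[OF V_closed(4)[OF V_closed(4)[OF x3 V(2)] V(3)] x])
      also have "x3 - s - t + x = m ^ 2"
        unfolding m(2) by (simp add: algebra_simps)
      finally have "m \<in> V"
        by (rule square_mem_V)
      then have md: "m * d \<in> M"
        using M_mult_left V(4) by blast
      have "(x - r) * (x3 - r) + (m * d + m * d) \<in> M"
        by (rule M_closed(2)[OF M_mult_right[OF xy(2) V_closed(4)[OF x3 V(1)]] M_closed(2)[OF md md]])
      also have "(x - r) * (x3 - r) + (m * d + m * d) = (r - s) * (r - t)"
        unfolding m(2) shifted_abscissa_identity[OF m(4)] by (simp add: algebra_simps)
      finally show False
        using M_prime[OF V_closed(4)[OF V(1,2)], of "r - t"] n by blast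
    qed
    then show ?thesis
      using m(1) xy(1) by (simp add: fiber_inf_def)
  qed
qed

text \<open>Here x - r is a unit and y - d lies in \<open>M\<close>, so the slope lies in
  \<open>M\<close> and the new abscissa is congruent to s + t - x, hence to
  \<open>t\<close>.\<close>

lemma add_root_point_fiber_other:
  assumes g: "splits_mod r s t d" and Q: "Q \<in> carrier E" "Q \<in> fiber s"
  shows "Affine r d \<boxplus> Q \<in> fiber t"
proof -
  obtain x y where xy: "Q = Affine x y" "x - s \<in> M"
    using Q(2) by (auto simp: fiber_def)
  have V: "r \<in> V" "s \<in> V" "t \<in> V" "d \<in> M" and n: "r - s \<notin> M"
    using g by (auto simp: splits_mod_def)
  have x: "x \<in> V"
    by (rule fiber_abscissa_in_V[OF splits_mod_swap12[OF g] xy(2)])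
  have y: "y \<in> M"
    using fiber_ordinate_in_M[OF splits_mod_swap12[OF g]] Q(1) xy by blast
  have xr: "x - r \<notin> M"
  proof
    assume "x - r \<in> M"
    then have "(x - s) - (x - r) \<in> M"
      using xy(2) M_closed(3) by blast
    then show False
      using n by simp
  qed
  then have "x \<noteq> r"
    using M_closed(1) by auto
  obtain m x3 y3 where m: "Affine r d \<boxplus> Affine x y = Affine x3 y3" "x3 = m ^ 2 + s + t - x"
    "m * (x - r) = y - d" "m * (2 * d + m * (x - r)) = (x - s) * (x - t)"
    by (rule add_root_point[OF g]) (use Q(1) xy(1) \<open>x \<noteq> r\<close> in auto)
  have "(x - r) * m \<in> M"
    using m(3) y V M_closed(3) by (simp add: mult.commute)
  then have m_M: "m \<in> M"
    using M_prime[OF V_closed(4)[OF x V(1)]] xr by blast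
  have "m * m - (x - s) \<in> M"
    by (rule M_closed(3)[OF M_mult_left[OF M_V[OF m_M] m_M] xy(2)])
  then have "x3 - t \<in> M"
    by (simp add: m(2) power2_eq_square algebra_simps)
  then show ?thesis
    using m(1) xy(1) by (simp add: fiber_def)
qed

section \<open>Independence, infinite order and rank\<close>

lemma root_points_independent:
  assumes g: "splits_mod r s t d"
    and eq: "Affine r d [^]\<^bsub>E\<^esub> (a::int) \<otimes>\<^bsub>E\<^esub> Affine s d [^]\<^bsub>E\<^esub> (b::int) = \<one>\<^bsub>E\<^esub>"
  shows "a = 0 \<and> b = 0"
proof -
  interpret E: comm_group E
    by (rule comm_group_E)
  define C where "C i j = (if i then if j then fiber t else fiber r
    else if j then fiber s else fiber_inf)" for i j
  have P: "Affine r d \<in> carrier E" "Affine s d \<in> carrier E"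
    using root_point_in_carrier[OF g] root_point_in_carrier[OF splits_mod_swap12[OF g]] .
  have step: "Affine r e \<boxplus> Q \<in> C (\<not> i) j" "Affine s e \<boxplus> Q \<in> C i (\<not> j)"
    if e: "splits_mod r s t e" and Q: "Q \<in> carrier E" "Q \<in> C i j" for e Q i j
  proof -
    \<comment> \<open>Translation by \<open>r\<close> also swaps the fibres of \<open>s\<close> and
      \<open>t\<close>, translation by \<open>s\<close> those of \<open>r\<close> and
      \<open>t\<close>; each swap needs both orders of its two roots.\<close>
    note p = e splits_mod_swap23[OF e] splits_mod_swap12[OF e]
      splits_mod_swap23[OF splits_mod_swap12[OF e]]
    show "Affine r e \<boxplus> Q \<in> C (\<not> i) j"
      using Q add_root_point_fiber_inf[OF p(1)] add_root_point_fiber_same[OF p(1)]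
        add_root_point_fiber_other[OF p(1)] add_root_point_fiber_other[OF p(2)]
      by (cases i; cases j) (auto simp: C_def)
    show "Affine s e \<boxplus> Q \<in> C i (\<not> j)"
      using Q add_root_point_fiber_inf[OF p(3)] add_root_point_fiber_same[OF p(3)]
        add_root_point_fiber_other[OF p(3)] add_root_point_fiber_other[OF p(4)]
      by (cases i; cases j) (auto simp: C_def)
  qed
  show ?thesis
  proof (rule E.independent_of_parity[OF P _ _ _ _ _ eq, where C = C])
    show "\<one>\<^bsub>E\<^esub> \<in> C False False"
      by (simp add: C_def fiber_inf_def)
    show "\<not> i \<and> \<not> j" if "\<one>\<^bsub>E\<^esub> \<in> C i j" for i j
      using that by (auto simp: C_def fiber_def split: if_splits)
    show "Q = \<one>\<^bsub>E\<^esub>" if "Q \<in> carrier E" "Q \<otimes>\<^bsub>E\<^esub> Q = \<one>\<^bsub>E\<^esub>" for Q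
      using that no_2_torsion by simp
  qed (use step[OF g] step[OF splits_mod_neg[OF g]] P in \<open>auto simp: inv_E\<close>)
qed

lemma root_point_infinite_order:
  assumes g: "splits_mod r s t d"
  shows "has_infinite_order E (Affine r d)"
  unfolding has_infinite_order_def
proof (intro allI impI notI)
  interpret E: comm_group E
    by (rule comm_group_E)
  fix n :: nat assume "n > 0" "Affine r d [^]\<^bsub>E\<^esub> n = \<one>\<^bsub>E\<^esub>"
  then have "Affine r d [^]\<^bsub>E\<^esub> int n \<otimes>\<^bsub>E\<^esub> Affine s d [^]\<^bsub>E\<^esub> (0::int) = \<one>\<^bsub>E\<^esub>"
    by (simp add: int_pow_int)
  then show False
    using root_points_independent[OF g] \<open>n > 0\<close> by fastforce
qed

lemma rank_ge_2:
  assumes g: "splits_mod r s t d"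
  shows "group_rank E \<ge> 2"
proof -
  interpret E: comm_group E
    by (rule comm_group_E)
  have "r \<noteq> s"
    using g M_closed(1) by (auto simp: splits_mod_def)
  then show ?thesis
    using root_point_in_carrier[OF g] root_point_in_carrier[OF splits_mod_swap12[OF g]]
      root_points_independent[OF g]
    by (intro E.group_rank_ge_2[of "Affine r d" "Affine s d"]) auto
qed

end

section \<open>The splitting field of the simplest cubic\<close>

lemma complex_field_ops:
  "carrier complex_field = UNIV" "monoid.mult complex_field = (*)" "monoid.one complex_field = 1"
  "ring.zero complex_field = 0" "ring.add complex_field = (+)"
  by (simp_all add: ring_of_type_algebra_def)

lemma complex_field_is_field: "field complex_field"
  by (rule field_from_type_algebra)

lemma complex_field_uminus: "\<ominus>\<^bsub>complex_field\<^esub> x = - x"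
proof -
  interpret field complex_field
    by (rule complex_field_is_field)
  show ?thesis
    by (rule minus_equality) (simp_all add: complex_field_ops)
qed

lemma complex_field_inv: "x \<noteq> 0 \<Longrightarrow> inv\<^bsub>complex_field\<^esub> x = inverse x"
proof -
  interpret field complex_field
    by (rule complex_field_is_field)
  assume "x \<noteq> 0"
  then show ?thesis
    by (intro inv_char) (simp_all add: complex_field_ops)
qed

lemma subfield_splitting_field: "subfield (splitting_field p) complex_field"
  unfolding splitting_field_def
  by (rule field.generate_field_is_subfield[OF complex_field_is_field]) (simp add: complex_field_ops)

lemma root_in_splitting_field: "poly p x = 0 \<Longrightarrow> x \<in> splitting_field p"
  unfolding splitting_field_def by (rule generate_field.incl) simp

lemma splitting_field_closed:
  fixes p defines "L \<equiv> splitting_field p"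
  shows "1 \<in> L" and "x \<in> L \<Longrightarrow> - x \<in> L" and "x \<in> L \<Longrightarrow> y \<in> L \<Longrightarrow> x + y \<in> L"
    and "x \<in> L \<Longrightarrow> y \<in> L \<Longrightarrow> x * y \<in> L" and "x \<in> L \<Longrightarrow> inverse x \<in> L"
proof -
  show 1: "1 \<in> L" and u: "x \<in> L \<Longrightarrow> - x \<in> L" and a: "x \<in> L \<Longrightarrow> y \<in> L \<Longrightarrow> x + y \<in> L"
    and "x \<in> L \<Longrightarrow> y \<in> L \<Longrightarrow> x * y \<in> L" for x y
    unfolding L_def splitting_field_def
    using generate_field.one[of complex_field] generate_field.a_inv[of _ complex_field]
      generate_field.eng_add[of _ complex_field] generate_field.eng_mult[of _ complex_field]
    by (simp_all add: complex_field_ops complex_field_uminus)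
  \<comment> \<open>The complex \<open>inverse\<close> sends 0 to 0, whereas the inverse of
    HOL-Algebra is specified only for units, so zero is treated separately.\<close>
  show "x \<in> L \<Longrightarrow> inverse x \<in> L"
    using generate_field.m_inv[of x complex_field]
    unfolding L_def splitting_field_def
    by (cases "x = 0") (simp_all add: complex_field_ops complex_field_inv)
qed

lemma of_int_mem:
  fixes A :: "'a::comm_ring_1 set"
  assumes "1 \<in> A" "\<And>x. x \<in> A \<Longrightarrow> - x \<in> A" "\<And>x y. x \<in> A \<Longrightarrow> y \<in> A \<Longrightarrow> x + y \<in> A"
  shows "of_int n \<in> A"
proof (induction n rule: int_induct[where k = 0])
  case base
  show ?case using assms(3)[OF assms(1) assms(2)[OF assms(1)]] by simp
next
  case (step1 i)
  then show ?case using assms(1,3) by simp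
next
  case (step2 i)
  then show ?case using assms(3)[OF _ assms(2)[OF assms(1)], of "of_int i"] by simp
qed

lemma nat_pow_eq_power:
  fixes R :: "complex ring"
  assumes "monoid.mult R = (*)" "monoid.one R = 1"
  shows "x [^]\<^bsub>R\<^esub> (n::nat) = x ^ n"
  by (induction n) (simp_all add: nat_pow_def assms mult.commute)

lemma eval_cubic:
  fixes R :: "complex ring"
  assumes "ring R" "monoid.mult R = (*)" "monoid.one R = 1" "ring.zero R = 0" "ring.add R = (+)"
  shows "ring.eval R [1, g2, g1, g0] x = poly [:g0, g1, g2, 1:] x"
  by (simp add: ring.eval.simps[OF assms(1)] assms(2-) nat_pow_eq_power algebra_simps
      power2_eq_square power3_eq_cube numeral_2_eq_2 numeral_3_eq_3)

lemma poly_list_cubic: "poly_list [:g0, g1, g2, 1::complex:] = [1, g2, g1, g0]"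
  by (simp add: poly_list_def)

lemma irreducible_over_no_root:
  assumes L: "subfield L complex_field" and "irreducible_over L [:g0, g1, g2, 1:]"
    and "g0 \<in> L" "g1 \<in> L" "g2 \<in> L" and x: "x \<in> L"
  shows "poly [:g0, g1, g2, 1:] x \<noteq> 0"
proof
  assume root: "poly [:g0, g1, g2, 1:] x = 0"
  let ?K = "complex_field\<lparr>carrier := L\<rparr>"
  interpret C: field complex_field
    by (rule complex_field_is_field)
  interpret K: field ?K
    using C.subfield_iff(2)[OF L] .
  let ?p = "[1, g2, g1, g0]"
  \<comment> \<open>Irreducibility is transferred to \<open>L\<close> as a field in its own right,
    whose roots are exactly those in \<open>L\<close>.\<close>
  have irr: "pirreducible\<^bsub>?K\<^esub> (carrier ?K) ?p"
    using assms(2) C.univ_poly_consistent[OF subfieldE(1)[OF L]]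
    by (simp add: irreducible_over_def poly_list_cubic)
  have p: "?p \<in> carrier (poly_ring ?K)"
    unfolding univ_poly_carrier[symmetric] polynomial_def
    using assms(3-5) subfieldE(1)[OF L] subringE(3)[OF subfieldE(1)[OF L]]
    by (simp add: complex_field_ops)
  have "K.eval ?p x = 0"
    using eval_cubic[OF K.ring_axioms, of g2 g1 g0 x] unfolding root by (simp add: complex_field_ops)
  then have "K.is_root ?p x"
    unfolding K.is_root_def using x by (simp add: complex_field_ops)
  then have "x \<in># K.roots ?p"
    using K.roots_mem_iff_is_root[OF p] by simp
  then show False
    using K.pirreducible_roots[OF p irr] by simp
qed

section \<open>Algebraic integers modulo the prime\<close>

lemma ring_of_integers_ops:
  "carrier (ring_of_integers L) = {x \<in> L. algebraic_int x}" "monoid.mult (ring_of_integers L) = (*)"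
  "monoid.one (ring_of_integers L) = 1" "ring.zero (ring_of_integers L) = 0" "ring.add (ring_of_integers L) = (+)"
  by (simp_all add: ring_of_integers_def complex_field_ops)

lemma coset_eq_image: "I +>\<^bsub>ring_of_integers L\<^esub> x = (\<lambda>i. i + x) ` I"
  by (auto simp: a_r_coset_def' ring_of_integers_ops)

text \<open>Closure of the algebraic integers of \<open>L\<close> under addition and multiplication is not proved but
  read off from the assumption that \<open>ring_of_integers L\<close> is a ring.\<close>

lemma is_subring_ring_of_integers:
  assumes "ring (ring_of_integers L)" "\<And>x. x \<in> L \<Longrightarrow> - x \<in> L"
  shows "is_subring (carrier (ring_of_integers L))"
proof -
  interpret ring "ring_of_integers L"
    by (rule assms(1))
  have "x - y \<in> carrier (ring_of_integers L)"
    if xy: "x \<in> carrier (ring_of_integers L)" "y \<in> carrier (ring_of_integers L)" for x y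
  proof -
    have "- y \<in> carrier (ring_of_integers L)"
      using xy(2) assms(2) by (simp add: ring_of_integers_ops)
    then show ?thesis
      using add.m_closed[OF xy(1), of "- y"] by (simp add: ring_of_integers_ops)
  qed
  then show ?thesis
    unfolding is_subring_def using one_closed m_closed by (simp add: ring_of_integers_ops(2,3))
qed

lemma is_ideal_ring_of_integers:
  assumes "ideal I (ring_of_integers L)"
  shows "is_ideal (carrier (ring_of_integers L)) I"
proof -
  interpret ideal I "ring_of_integers L"
    by (rule assms)
  show ?thesis
    unfolding is_ideal_def using a_subset additive_subgroup.zero_closed[OF is_additive_subgroup]
      additive_subgroup.a_closed[OF is_additive_subgroup] I_l_closed
    by (simp add: ring_of_integers_ops(2,4,5))
qed

lemma coset_eq_iff:
  assumes "is_subring B" "is_ideal B I"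
  shows "(\<lambda>i. i + x) ` I = (\<lambda>i. i + y) ` I \<longleftrightarrow> x - y \<in> I"
proof
  assume "(\<lambda>i. i + x) ` I = (\<lambda>i. i + y) ` I"
  moreover have "x \<in> (\<lambda>i. i + x) ` I"
    using ideal_0[OF assms(2)] by (intro image_eqI[of _ _ 0]) auto
  ultimately obtain i where "i \<in> I" "x = i + y"
    by auto
  then show "x - y \<in> I"
    by simp
next
  have sub: "(\<lambda>i. i + x) ` I \<subseteq> (\<lambda>i. i + y) ` I" if "x - y \<in> I" for x y
  proof
    fix z assume "z \<in> (\<lambda>i. i + x) ` I"
    then obtain i where "i \<in> I" "z = (i + (x - y)) + y"
      by auto
    then show "z \<in> (\<lambda>i. i + y) ` I"
      using ideal_add[OF assms(2) _ that] by blast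
  qed
  assume "x - y \<in> I"
  then show "(\<lambda>i. i + x) ` I = (\<lambda>i. i + y) ` I"
    using sub[of x y] sub[of y x] ideal_uminus[OF assms, of "x - y"] by auto
qed

text \<open>Modulo the prime the constant \<open>e\<close> disappears, and primality confines all
  roots to the classes of \<open>r\<close>, \<open>s\<close>, \<open>t\<close>. Three distinct roots
  therefore require three distinct classes.\<close>

lemma distinct_roots_mod_prime:
  fixes L I and g0 g1 g2 r s t e :: complex
  defines "R \<equiv> ring_of_integers L"
  assumes I: "primeideal I R" and R: "is_subring (carrier R)" and II: "is_ideal (carrier R) I"
    and g: "[:g0, g1, g2, 1:] = [:- r, 1:] * [:- s, 1:] * [:- t, 1:] + [:e:]"
    and in_R: "g0 \<in> carrier R" "g1 \<in> carrier R" "g2 \<in> carrier R"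
      "r \<in> carrier R" "s \<in> carrier R" "t \<in> carrier R" and e: "e \<in> I"
    and roots: "has_distinct_roots (R Quot I) (reduce_poly R I [:g0, g1, g2, 1:])"
  shows "r - s \<notin> I" "r - t \<notin> I" "s - t \<notin> I"
proof -
  interpret primeideal I R
    by (rule I)
  interpret h: ring_hom_ring R "R Quot I" "(+>\<^bsub>R\<^esub>) I"
    by (rule rcos_ring_hom_ring)
  note ops = ring_of_integers_ops[of L, folded R_def]
  let ?h = "\<lambda>x. I +>\<^bsub>R\<^esub> x"
  let ?p = "reduce_poly R I [:g0, g1, g2, 1:]"
  have h_eq: "?h x = ?h y \<longleftrightarrow> x - y \<in> I" for x y
    unfolding R_def coset_eq_image using coset_eq_iff[OF R II] .
  have "{x \<in> carrier (R Quot I). ring.eval (R Quot I) ?p x = \<zero>\<^bsub>R Quot I\<^esub>} \<subseteq> {?h r, ?h s, ?h t}"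
  proof
    fix x assume "x \<in> {x \<in> carrier (R Quot I). ring.eval (R Quot I) ?p x = \<zero>\<^bsub>R Quot I\<^esub>}"
    then have x: "x \<in> carrier (R Quot I)" and ev: "ring.eval (R Quot I) ?p x = \<zero>\<^bsub>R Quot I\<^esub>"
      by blast+
    obtain z where z: "z \<in> carrier R" "x = ?h z"
      using x unfolding FactRing_def A_RCOSETS_def' partial_object.simps by blast
    have "set [1, g2, g1, g0] \<subseteq> carrier R"
      using in_R subring_1[OF R] by simp
    from h.eval_hom'[OF z(1) this]
    have "?h (poly [:g0, g1, g2, 1:] z) = ring.eval (R Quot I) ?p x"
      unfolding reduce_poly_def poly_list_cubic z(2) eval_cubic[OF ring_axioms ops(2-5)] .
    also have "\<dots> = ?h 0"
      unfolding ev using h.hom_zero[unfolded ops(4)] by (rule sym)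
    finally have "poly [:g0, g1, g2, 1:] z \<in> I"
      by (simp only: h_eq diff_zero)
    then have "poly [:g0, g1, g2, 1:] z - e \<in> I"
      by (rule ideal_diff[OF R II _ e])
    also have "poly [:g0, g1, g2, 1:] z - e = (z - r) * ((z - s) * (z - t))"
      unfolding g poly_add poly_mult by simp
    finally have prod: "(z - r) * ((z - s) * (z - t)) \<in> I" .
    have "z - r \<in> carrier R" "z - s \<in> carrier R" "z - t \<in> carrier R"
      using z(1) in_R by (auto intro: subring_diff[OF R])
    then have "z - r \<in> I \<or> z - s \<in> I \<or> z - t \<in> I"
      using I_prime[unfolded ops(2), OF _ _ prod] I_prime[unfolded ops(2), of "z - s" "z - t"]
        subring_mult[OF R, of "z - s" "z - t"] by blast
    then show "x \<in> {?h r, ?h s, ?h t}"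
      unfolding z(2) insert_iff h_eq by blast
  qed
  then have "card {x \<in> carrier (R Quot I). ring.eval (R Quot I) ?p x = \<zero>\<^bsub>R Quot I\<^esub>}
      \<le> card {?h r, ?h s, ?h t}"
    by (intro card_mono) simp_all
  moreover have "length ?p = 4"
    by (simp add: reduce_poly_def poly_list_cubic)
  ultimately have three: "3 \<le> card {?h r, ?h s, ?h t}"
    using roots unfolding has_distinct_roots_def by simp
  have "{?h r, ?h s, ?h t} \<noteq> {u, v}" for u v
  proof
    assume "{?h r, ?h s, ?h t} = {u, v}"
    moreover have "card {u, v} \<le> 2"
      by (simp add: card_insert_if)
    ultimately show False
      using three by simp
  qed
  then have "?h r \<noteq> ?h s" "?h r \<noteq> ?h t" "?h s \<noteq> ?h t"
    by blast+
  then show "r - s \<notin> I" "r - t \<notin> I" "s - t \<notin> I"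
    by (simp_all add: h_eq)
qed

text \<open>An odd integer in \<open>I\<close> would, together with 2, put 1 into \<open>I\<close>.
  Used in contraposition, to keep 2 outside the prime.\<close>

lemma lies_over_2:
  assumes B: "is_subring B" and I: "is_ideal B I" and "1 \<notin> I" "2 \<in> I"
  shows "lies_over I 2"
proof -
  have mem: "of_int n \<in> B" for n
    by (rule of_int_mem) (use B in \<open>auto intro: subring_1 subring_add subring_uminus\<close>)
  have even: "of_int (2 * k) \<in> I" for k
    using ideal_mult[OF I mem assms(4), of k] by (simp add: mult.commute)
  have "2 dvd n" if "of_int n \<in> I" for n
  proof (rule ccontr)
    assume "\<not> 2 dvd n"
    then obtain k where "n = 2 * k + 1"
      by (auto elim: oddE)
    then have "of_int n - of_int (2 * k) = (1::complex)"
      by simp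
    then show False
      using ideal_diff[OF B I that even, of k] assms(3) by simp
  qed
  then show ?thesis
    unfolding lies_over_def using even by (auto elim!: dvdE)
qed

lemma cubic_f_coeffs: "cubic_f a = [:- 1, - of_int (a + 3), - of_int a, 1:]"
  by (simp add: cubic_f_def power3_eq_cube one_pCons)

lemma algebraic_int_root_cubic_f: "poly (cubic_f a) x = 0 \<Longrightarrow> algebraic_int x"
  by (rule algebraic_int.intros[of "cubic_f a"])
    (auto simp: cubic_f_coeffs coeff_pCons split: nat.split)

theorem theorem3p10:
  fixes a :: int and \<rho> \<rho>\<^sub>2 \<rho>\<^sub>3 d :: complex and \<pp> :: "complex set"
  defines "f \<equiv> cubic_f a"
  defines "L \<equiv> splitting_field f"
  defines "O\<^sub>L \<equiv> ring_of_integers L"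
  defines "g \<equiv> f + [:d ^ 2:]"
  defines "E \<equiv> elliptic_curve_group L g"
  assumes "a \<ge> 1"
    and "f = [:- \<rho>, 1:] * [:- \<rho>\<^sub>2, 1:] * [:- \<rho>\<^sub>3, 1:]"
    and "primeideal \<pp> O\<^sub>L" and "\<pp> \<noteq> {0}" and "\<not> lies_over \<pp> 2"
    and "d \<in> L"
    and "d \<in> \<pp>"
    and "irreducible_over L g"
    and "reduce_poly O\<^sub>L \<pp> g = reduce_poly O\<^sub>L \<pp> f"
    and "has_distinct_roots (O\<^sub>L Quot \<pp>) (reduce_poly O\<^sub>L \<pp> g)"
  shows "(\<forall>r \<in> {\<rho>, \<rho>\<^sub>2, \<rho>\<^sub>3}. \<forall>s \<in> {d, - d}. Affine r s \<in> carrier E)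
    \<and> (\<forall>r \<in> {\<rho>, \<rho>\<^sub>2, \<rho>\<^sub>3}. \<forall>s \<in> {d, - d}. has_infinite_order E (Affine r s))
    \<and> group_rank E \<ge> 2"
proof -
  define g0 g1 g2 :: complex
    where "g0 = d ^ 2 - 1" and "g1 = - of_int (a + 3)" and "g2 = - of_int a"
  have g: "g = [:g0, g1, g2, 1:]"
    by (simp add: g_def f_def cubic_f_coeffs g0_def g1_def g2_def)
  have g_split: "g = [:- \<rho>, 1:] * [:- \<rho>\<^sub>2, 1:] * [:- \<rho>\<^sub>3, 1:] + [:d ^ 2:]"
    unfolding g_def assms(7) ..
  note L = splitting_field_closed[where p = f, folded L_def]
  interpret \<pp>: primeideal \<pp> O\<^sub>L
    by (rule assms(8))
  let ?A = "carrier O\<^sub>L"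
  have A: "is_subring ?A"
    using is_subring_ring_of_integers[of L] \<pp>.ring_axioms L(2) unfolding O\<^sub>L_def by blast
  have \<pp>: "is_ideal ?A \<pp>"
    using is_ideal_ring_of_integers \<pp>.ideal_axioms unfolding O\<^sub>L_def by blast
  have mem_A: "x \<in> ?A \<longleftrightarrow> x \<in> L \<and> algebraic_int x" for x
    by (simp add: O\<^sub>L_def ring_of_integers_ops)
  have one: "1 \<notin> \<pp>"
    using \<pp>.one_imp_carrier \<pp>.I_notcarr by (auto simp: O\<^sub>L_def ring_of_integers_ops(3))
  have prime: "x \<in> \<pp> \<or> y \<in> \<pp>" if "x \<in> ?A" "y \<in> ?A" "x * y \<in> \<pp>" for x y
    using \<pp>.I_prime[OF that(1,2)] that(3) by (simp add: O\<^sub>L_def ring_of_integers_ops(2))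
  have two: "2 \<notin> \<pp>"
    using lies_over_2[OF A \<pp> one] assms(10) by blast
  have int_A: "of_int n \<in> ?A" for n
    by (rule of_int_mem) (use A in \<open>auto intro: subring_1 subring_add subring_uminus\<close>)
  have roots: "poly f \<rho> = 0" "poly f \<rho>\<^sub>2 = 0" "poly f \<rho>\<^sub>3 = 0"
    unfolding assms(7) poly_mult by simp_all
  then have \<rho>: "\<rho> \<in> ?A" "\<rho>\<^sub>2 \<in> ?A" "\<rho>\<^sub>3 \<in> ?A"
    using root_in_splitting_field[of f] algebraic_int_root_cubic_f unfolding mem_A L_def f_def by blast+
  have dA: "d \<in> ?A"
    by (rule ideal_subset[OF \<pp> assms(12)])
  have d2: "d ^ 2 \<in> \<pp>"
    unfolding power2_eq_square by (rule ideal_mult[OF \<pp> dA assms(12)])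
  have gA: "g0 \<in> ?A" "g1 \<in> ?A" "g2 \<in> ?A"
    unfolding g0_def g1_def g2_def using int_A ideal_subset[OF \<pp> d2]
    by (auto intro: subring_diff[OF A] subring_uminus[OF A] subring_1[OF A] simp del: of_int_add)
  note distinct = distinct_roots_mod_prime[of \<pp> L, folded O\<^sub>L_def, OF assms(8) A \<pp>
      g_split[unfolded g] gA \<rho> d2 assms(15)[unfolded g]]
  obtain V M where V: "is_subring V" "is_ideal V M" "1 \<notin> M"
    "\<And>x. x \<notin> V \<Longrightarrow> inverse x \<in> M" "\<And>x. x \<in> V \<Longrightarrow> x \<notin> M \<Longrightarrow> inverse x \<in> V"
    "?A \<subseteq> V" "\<pp> \<subseteq> M" "\<And>x. x \<in> ?A \<Longrightarrow> x \<in> M \<Longrightarrow> x \<in> \<pp>"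
    using valuation_ring_extending_prime[OF A \<pp> one prime] by blast
  have no_root: "poly g x \<noteq> 0" if "x \<in> L" for x
    using irreducible_over_no_root[OF subfield_splitting_field[of f], folded L_def] assms(13) gA that
    unfolding g mem_A by blast
  have L_coeffs: "g0 \<in> L" "g1 \<in> L" "g2 \<in> L"
    using gA unfolding mem_A by blast+
  interpret red: reduction g0 g1 g2 g L V M
  proof unfold_locales
    show "g \<equiv> [:g0, g1, g2, 1:]"
      by (rule eq_reflection[OF g])
  qed (fact L L_coeffs V no_root no_root[unfolded g] | simp)+
  \<comment> \<open>\<open>M\<close> meets the ring of integers only in \<open>\<pp>\<close>, so
    what is known to lie outside \<open>\<pp>\<close> also lies outside \<open>M\<close>.\<close>
  have "2 \<in> ?A"
    using int_A[of 2] by simp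
  then have "2 \<notin> M"
    using V(8) two by blast
  moreover have "\<rho> - \<rho>\<^sub>2 \<notin> M" "\<rho> - \<rho>\<^sub>3 \<notin> M" "\<rho>\<^sub>2 - \<rho>\<^sub>3 \<notin> M"
    using V(8)[OF subring_diff[OF A \<rho>(1,2)]] V(8)[OF subring_diff[OF A \<rho>(1,3)]]
      V(8)[OF subring_diff[OF A \<rho>(2,3)]] distinct by blast+
  moreover have "\<rho> \<in> L" "\<rho>\<^sub>2 \<in> L" "\<rho>\<^sub>3 \<in> L" "\<rho> \<in> V" "\<rho>\<^sub>2 \<in> V" "\<rho>\<^sub>3 \<in> V" "d \<in> M"
    using \<rho> mem_A V(6,7) assms(12) by blast+
  ultimately have split: "red.splits_mod \<rho> \<rho>\<^sub>2 \<rho>\<^sub>3 d"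
    unfolding red.splits_mod_def using g_split assms(11) by blast
  have split': "red.splits_mod \<rho> \<rho>\<^sub>2 \<rho>\<^sub>3 e" if "e \<in> {d, - d}" for e
    using that split red.splits_mod_neg[OF split] by blast
  \<comment> \<open>Each root is moved to the first position, where the lemmas on root points
    apply.\<close>
  have "\<exists>s t. red.splits_mod r s t e" if "r \<in> {\<rho>, \<rho>\<^sub>2, \<rho>\<^sub>3}" "e \<in> {d, - d}" for r e
    using that(1) split'[OF that(2)] red.splits_mod_swap12[OF split'[OF that(2)]]
      red.splits_mod_swap12[OF red.splits_mod_swap23[OF split'[OF that(2)]]] by blast
  then have "Affine r e \<in> carrier E \<and> has_infinite_order E (Affine r e)"
    if "r \<in> {\<rho>, \<rho>\<^sub>2, \<rho>\<^sub>3}" "e \<in> {d, - d}" for r e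
    using that red.root_point_in_carrier red.root_point_infinite_order unfolding E_def by meson
  moreover have "group_rank E \<ge> 2"
    unfolding E_def by (rule red.rank_ge_2[OF split])
  ultimately show ?thesis
    by blast
qed

end
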